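(* Let $\alpha\ge-1$, $n$ a positive integer, $\psi$ analytic on $\mathbb D$ and $\varphi$ an analytic self-map of $\mathbb D$ such that $D_{\psi,\varphi,n}$ is compact on $\mathcal H_\alpha$. Suppose $w\in\mathbb D$ satisfies $\varphi(w)=w$ and $\psi$ has a zero at $w$ of order exactly $n$ (i.e. $\psi^{(j)}(w)=0$ for $0\le j\le n-1$ and $\psi^{(n)}(w)\ne0$). Then, with $N=\big\lfloor \frac{n}{1-|\varphi'(w)|}\big\rfloor$, $$r_\alpha(D_{\psi,\varphi,n})=\binom{N}{n}\,|\psi^{(n)}(w)|\,|\varphi'(w)|^{N-n}.$$
   Context: For $\alpha=-1$, $\mathcal H_\alpha$ denotes the Hardy space $H^2$ on the open unit disk $\mathbb D$; for $\alpha>-1$, $\mathcal H_\alpha$ denotes the weighted Bergman space $A^2_\alpha$ of analytic $f$ on $\mathbb D$ with $\int_{\mathbb D}|f(z)|^2(\alpha+1)(1-|z|^2)^\alpha\,dA(z)<\infty$, $dA$ normalized area measure. $D_{\psi,\varphi,n}f=\psi\cdot(f^{(n)}\circ\varphi)$. $r_\alpha(T)$ is the spectral radius of $T$ on $\mathcal H_\alpha$; $\lfloor\cdot\rfloor$ is the greatest integer function. Convention: $0^0=1$. *)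

theory Defs
  imports "HOL-Analysis.Analysis"
begin

text \<open>Squared norm in H_alpha (possibly infinite).
  alpha = -1: Hardy space H^2, norm^2 = sup_{0<r<1} (1/2pi) int_0^{2pi} |f(r e^{it})|^2 dt.
  alpha > -1: weighted Bergman space A^2_alpha with normalized area measure dA = dx dy / pi.\<close>
definition Hnorm2 :: "real \<Rightarrow> (complex \<Rightarrow> complex) \<Rightarrow> ennreal" where
  "Hnorm2 \<alpha> f =
     (if \<alpha> = -1 then
        (SUP r\<in>{0<..<1::real}. \<integral>\<^sup>+ t \<in> {0..2*pi}.
            ennreal ((cmod (f (complex_of_real r * cis t)))\<^sup>2 / (2*pi)) \<partial>lborel)
      else
        \<integral>\<^sup>+ z \<in> ball (0::complex) 1.
            ennreal ((cmod (f z))\<^sup>2 * (\<alpha> + 1) * (1 - (cmod z)\<^sup>2) powr \<alpha> / pi) \<partial>lborel)"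

text \<open>Elements of H_alpha: analytic functions on the unit disk (normalized to be 0 off the disk,
  so that equality of elements means equality on the disk) with finite norm.\<close>
definition Hspace :: "real \<Rightarrow> (complex \<Rightarrow> complex) set" where
  "Hspace \<alpha> = {f. f holomorphic_on ball 0 1 \<and> (\<forall>z. z \<notin> ball 0 1 \<longrightarrow> f z = 0)
                    \<and> Hnorm2 \<alpha> f < \<infinity>}"

definition Dop :: "(complex \<Rightarrow> complex) \<Rightarrow> (complex \<Rightarrow> complex) \<Rightarrow> nat
                    \<Rightarrow> (complex \<Rightarrow> complex) \<Rightarrow> (complex \<Rightarrow> complex)" where
  "Dop \<psi> \<phi> n f = (\<lambda>z. if z \<in> ball 0 1 then \<psi> z * (deriv ^^ n) f (\<phi> z) else 0)"

definition Hcompact_op :: "real \<Rightarrow> ((complex \<Rightarrow> complex) \<Rightarrow> (complex \<Rightarrow> complex)) \<Rightarrow> bool" where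
  "Hcompact_op \<alpha> T \<longleftrightarrow>
     (\<forall>f \<in> Hspace \<alpha>. T f \<in> Hspace \<alpha>) \<and>
     (\<forall>(fs :: nat \<Rightarrow> complex \<Rightarrow> complex) (B::real). (\<forall>k. fs k \<in> Hspace \<alpha> \<and> Hnorm2 \<alpha> (fs k) \<le> ennreal B) \<longrightarrow>
        (\<exists>r g. strict_mono r \<and> g \<in> Hspace \<alpha> \<and>
           ((\<lambda>k. Hnorm2 \<alpha> (\<lambda>z. T (fs (r k)) z - g z)) \<longlongrightarrow> 0) sequentially))"

text \<open>Spectrum of T on H_alpha: lambda such that T - lambda I is not a bijection of H_alpha
  (for bounded T on a Banach space the inverse is then automatically bounded).\<close>
definition Hspectrum :: "real \<Rightarrow> ((complex \<Rightarrow> complex) \<Rightarrow> (complex \<Rightarrow> complex)) \<Rightarrow> complex set" where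
  "Hspectrum \<alpha> T = {c. \<not> bij_betw (\<lambda>f z. T f z - c * f z) (Hspace \<alpha>) (Hspace \<alpha>)}"

definition Hspectral_radius :: "real \<Rightarrow> ((complex \<Rightarrow> complex) \<Rightarrow> (complex \<Rightarrow> complex)) \<Rightarrow> real" where
  "Hspectral_radius \<alpha> T = Sup (cmod ` Hspectrum \<alpha> T)"

end

theory Submission
  imports Defs "HOL-Complex_Analysis.Complex_Analysis" "HOL-Library.Function_Algebras"
begin

text \<open>Expanding around the fixed point \<open>w\<close>, an \<open>f\<close> vanishing to order \<open>m\<close> at \<open>w\<close> is mapped by
  \<open>T = D_{\<psi>,\<phi>,n}\<close> to a function vanishing to order \<open>m\<close>, and the \<open>m\<close>-th derivative at \<open>w\<close> is multiplied
  by \<open>d_m = binom(m,n) \<psi>^(n)(w) \<phi>'(w)^(m-n)\<close>. So \<open>T\<close> is lower triangular with diagonal \<open>(d_m)\<close>: every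
  eigenvalue is some \<open>d_m\<close>, and every \<open>d_m\<close> lies in the spectrum. By compactness each nonzero
  spectral value is an eigenvalue (Fredholm alternative), so the nonzero spectrum is the set of
  nonzero \<open>d_m\<close>. It is bounded, which forces \<open>|\<phi>'(w)| < 1\<close>; then for \<open>m \<ge> n\<close> one has
  \<open>|d_{m+1}| \<ge> |d_m|\<close> if \<open>m + 1 \<le> n / (1 - |\<phi>'(w)|)\<close> and \<open>|d_{m+1}| \<le> |d_m|\<close> otherwise, so the
  maximum is attained at \<open>m = N\<close>.\<close>

section \<open>Compact operators on normed subspaces\<close>

text \<open>The spaces to be treated are sets of functions depending on a real parameter, so the
  norm is a function \<open>N\<close> whose axioms refer to a subspace \<open>V\<close>. Limits are
  supplied later by compactness of the operator.\<close>

locale normed_subspace = vector_space scale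
  for scale :: "'a::real_normed_field \<Rightarrow> 'b::ab_group_add \<Rightarrow> 'b" (infixr \<open>*s\<close> 75) +
  fixes V :: "'b set" and N :: "'b \<Rightarrow> real"
  assumes subspace_V: "subspace V"
    and N_nonneg: "\<And>x. 0 \<le> N x"
    and N_triangle: "\<And>x y. x \<in> V \<Longrightarrow> y \<in> V \<Longrightarrow> N (x + y) \<le> N x + N y"
    and N_scale: "\<And>c x. x \<in> V \<Longrightarrow> N (c *s x) = norm c * N x"
    and N_zeroD: "\<And>x. x \<in> V \<Longrightarrow> N x = 0 \<Longrightarrow> x = 0"
begin

lemmas V_closed [simp, intro] =
  subspace_0[OF subspace_V] subspace_add[OF subspace_V]
  subspace_diff[OF subspace_V] subspace_scale[OF subspace_V]

lemma N_zero [simp]: "N 0 = 0"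
  using N_scale[of 0 0] by simp

lemma N_pos: "x \<in> V \<Longrightarrow> x \<noteq> 0 \<Longrightarrow> 0 < N x"
  using N_zeroD N_nonneg by (metis less_eq_real_def)

lemma N_minus_commute: "x \<in> V \<Longrightarrow> y \<in> V \<Longrightarrow> N (x - y) = N (y - x)"
  using N_scale[of "y - x" "-1"] by simp

lemma N_triangle_diff:
  assumes "x \<in> V" "y \<in> V" "z \<in> V"
  shows "N (x - z) \<le> N (x - y) + N (y - z)"
  using N_triangle[of "x - y" "y - z"] assms by simp

lemma N_diff_le: "x \<in> V \<Longrightarrow> y \<in> V \<Longrightarrow> N (x - y) \<le> N x + N y"
  using N_triangle_diff[of x 0 y] N_minus_commute[of 0 y] by simp

lemma N_le_diff: "x \<in> V \<Longrightarrow> y \<in> V \<Longrightarrow> N x \<le> N (x - y) + N y"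
  using N_triangle_diff[of x y 0] by simp

lemma N_normalize:
  assumes "x \<in> V" "x \<noteq> 0"
  shows "N (of_real (inverse (N x)) *s x) = 1"
  using N_pos[OF assms] assms by (simp add: N_scale norm_inverse)

definition N_closed :: "'b set \<Rightarrow> bool" where
  "N_closed W \<longleftrightarrow>
     (\<forall>x y. (\<forall>k::nat. x k \<in> W) \<and> y \<in> V \<and> (\<lambda>k. N (x k - y)) \<longlonglongrightarrow> 0 \<longrightarrow> y \<in> W)"

text \<open>A point \<open>x\<close> outside \<open>W\<close> has positive distance from
  \<open>W\<close> because \<open>W\<close> is closed; normalising \<open>x - v0\<close> for an
  almost nearest \<open>v0\<close> gives the vector. In \<open>S_surj\<close> this yields well
  separated unit vectors along a chain of ranges.\<close>

lemma riesz_lemma: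
  assumes U: "subspace U" "U \<subseteq> V" and W: "subspace W" "W \<subset> U" "N_closed W"
  obtains u where "u \<in> U" "N u = 1" "\<And>v. v \<in> W \<Longrightarrow> 1 / 2 \<le> N (u - v)"
proof -
  obtain x where x: "x \<in> U" "x \<notin> W" using W by blast
  define D where "D = (\<lambda>v. N (x - v)) ` W"
  have bdd: "bdd_below D" unfolding D_def using N_nonneg by (auto intro!: bdd_belowI[of _ 0])
  have ne: "D \<noteq> {}" unfolding D_def using subspace_0[OF W(1)] by blast
  have xV: "x \<in> V" and WV: "W \<subseteq> V" using x U W by auto
  have "Inf D \<ge> 0" using ne by (intro cInf_greatest) (auto simp: D_def N_nonneg)
  moreover have "Inf D \<noteq> 0"
  proof
    assume 0: "Inf D = 0"
    have "\<exists>v\<in>W. N (x - v) < inverse (real (Suc k))" for k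
      using cInf_lessD[OF ne, of "inverse (real (Suc k))"] 0 by (auto simp: D_def)
    then obtain v where v: "\<And>k. v k \<in> W" "\<And>k. N (x - v k) < inverse (real (Suc k))"
      by metis
    have "(\<lambda>k. N (v k - x)) \<longlonglongrightarrow> 0"
    proof (rule tendsto_sandwich[OF _ _ tendsto_const LIMSEQ_inverse_real_of_nat])
      show "\<forall>\<^sub>F k in sequentially. N (v k - x) \<le> inverse (real (Suc k))"
        using v WV xV by (auto simp: N_minus_commute[of _ x] subset_iff less_imp_le)
    qed (simp add: N_nonneg)
    then show False using W(3) v xV x(2) unfolding N_closed_def by blast
  qed
  ultimately have pos: "Inf D > 0" by simp
  \<comment> \<open>Coming within a factor 2 of the distance is what produces the constant
    1/2.\<close>
  obtain v0 where v0: "v0 \<in> W" "N (x - v0) < 2 * Inf D"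
    using cInf_lessD[OF ne, of "2 * Inf D"] pos by (auto simp: D_def)
  define s where "s = N (x - v0)"
  have xv: "x - v0 \<in> V" "x - v0 \<noteq> 0" using xV v0 WV x by auto
  then have s: "s > 0" unfolding s_def by (rule N_pos)
  define u where "u = of_real (inverse s) *s (x - v0)"
  show thesis
  proof
    show "u \<in> U" unfolding u_def using U x v0 W by (auto intro!: subspace_scale subspace_diff)
    show "N u = 1" unfolding u_def s_def using N_normalize xv by blast
    fix v assume v: "v \<in> W"
    \<comment> \<open>After scaling by \<open>s\<close>, the distance from \<open>u\<close> to
      \<open>v\<close> becomes the distance from \<open>x\<close> to this point of \<open>W\<close>,
      which is at least \<open>Inf D\<close>.\<close>
    have w: "v0 + of_real s *s v \<in> W" using v v0 W by (auto intro!: subspace_scale subspace_add)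
    have "u - v = of_real (inverse s) *s (x - (v0 + of_real s *s v))"
      using s by (simp add: u_def algebra_simps scale_right_distrib scale_right_diff_distrib)
    then have "N (u - v) = inverse s * N (x - (v0 + of_real s *s v))"
      using s w WV xV by (simp add: N_scale norm_inverse subset_iff)
    moreover have "Inf D \<le> N (x - (v0 + of_real s *s v))"
      using w bdd by (auto simp: D_def intro!: cInf_lower)
    ultimately have "N (u - v) \<ge> inverse s * Inf D" using s by simp
    moreover have "inverse s * Inf D \<ge> 1 / 2"
      using v0(2) s by (simp add: s_def field_simps)
    ultimately show "1 / 2 \<le> N (u - v)" by simp
  qed
qed

end

section \<open>Boundedness and continuity of compact operators\<close>

locale compact_operator = normed_subspace scale V N
  for scale :: "'a::real_normed_field \<Rightarrow> 'b::ab_group_add \<Rightarrow> 'b" (infixr \<open>*s\<close> 75)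
    and V N +
  fixes T :: "'b \<Rightarrow> 'b"
  assumes T_in_V [simp, intro]: "\<And>x. x \<in> V \<Longrightarrow> T x \<in> V"
    and T_add: "\<And>x y. x \<in> V \<Longrightarrow> y \<in> V \<Longrightarrow> T (x + y) = T x + T y"
    and T_scale: "\<And>c x. x \<in> V \<Longrightarrow> T (c *s x) = c *s T x"
    and T_compact: "\<And>(x::nat \<Rightarrow> 'b) B. (\<And>k. x k \<in> V) \<Longrightarrow> (\<And>k. N (x k) \<le> B) \<Longrightarrow>
      \<exists>r g. strict_mono r \<and> g \<in> V \<and> (\<lambda>k. N (T (x (r k)) - g)) \<longlonglongrightarrow> 0"
begin

lemma T_diff: "x \<in> V \<Longrightarrow> y \<in> V \<Longrightarrow> T (x - y) = T x - T y"
  using T_add[of x "- 1 *s y"] T_scale[of y "-1"] subspace_neg[OF subspace_V] by simp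

lemma T_zero [simp]: "T 0 = 0"
  using T_diff[of 0 0] by simp

text \<open>Otherwise there are unit vectors \<open>y k\<close> with \<open>N (T (y k)) > k\<close>;
  the images along any subsequence are unbounded and cannot converge.\<close>

lemma T_bounded: obtains B where "B > 0" "\<And>x. x \<in> V \<Longrightarrow> N (T x) \<le> B * N x"
proof -
  have "\<exists>B. \<forall>x\<in>V. N (T x) \<le> B * N x"
  proof (rule ccontr)
    assume "\<nexists>B. \<forall>x\<in>V. N (T x) \<le> B * N x"
    then have "\<exists>x\<in>V. N (T x) > real k * N x" for k :: nat by (meson not_le)
    then obtain x where x: "\<And>k. x k \<in> V" "\<And>k. N (T (x k)) > real k * N (x k)" by metis
    have x0: "x k \<noteq> 0" for k using x(2)[of k] by auto
    define y where "y k = of_real (inverse (N (x k))) *s x k" for k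
    have y: "y k \<in> V" "N (y k) = 1" for k
      unfolding y_def using x(1) x0 N_normalize by auto
    have Ty: "N (T (y k)) > real k" for k
      using x(2)[of k] N_pos[OF x(1) x0, of k] x(1)
      by (simp add: y_def T_scale N_scale norm_inverse) (simp add: field_simps)
    obtain r g where r: "strict_mono r" "g \<in> V" "(\<lambda>k. N (T (y (r k)) - g)) \<longlonglongrightarrow> 0"
      using T_compact[of y 1] y by auto
    obtain K where K: "\<forall>k. norm (N (T (y (r k)) - g)) \<le> K"
      using convergent_imp_Bseq[OF convergentI[OF r(3)]] unfolding Bseq_def by blast
    obtain k :: nat where k: "real k > K + N g" using reals_Archimedean2 by blast
    have "real k \<le> real (r k)" using r(1) by (simp add: seq_suble)
    also have "\<dots> < N (T (y (r k)))" by (rule Ty)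
    also have "\<dots> \<le> N (T (y (r k)) - g) + N g" using N_le_diff y r by auto
    also have "\<dots> \<le> K + N g" using K[rule_format, of k] by (simp add: N_nonneg)
    finally show False using k by simp
  qed
  then obtain B where B: "\<And>x. x \<in> V \<Longrightarrow> N (T x) \<le> B * N x" by blast
  show thesis
  proof (rule that[of "max B 1"])
    fix x assume "x \<in> V"
    have "N (T x) \<le> B * N x" using B \<open>x \<in> V\<close> .
    also have "\<dots> \<le> max B 1 * N x" by (intro mult_right_mono) (auto simp: N_nonneg)
    finally show "N (T x) \<le> max B 1 * N x" .
  qed simp
qed

text \<open>Serves to exclude \<open>cmod (deriv \<phi> w) \<ge> 1\<close>, where the diagonal
  entries would be unbounded.\<close>

lemma eigenvalue_bound:
  obtains B where "\<And>c x. x \<in> V \<Longrightarrow> x \<noteq> 0 \<Longrightarrow> T x = c *s x \<Longrightarrow> norm c \<le> B"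
proof -
  obtain B where B: "B > 0" "\<And>x. x \<in> V \<Longrightarrow> N (T x) \<le> B * N x" by (rule T_bounded) blast
  show thesis
  proof
    fix c x assume x: "x \<in> V" "x \<noteq> 0" "T x = c *s x"
    then have "norm c * N x \<le> B * N x" using B(2)[of x] by (simp add: N_scale)
    then show "norm c \<le> B" using N_pos[of x] x by simp
  qed
qed

lemma T_lim:
  assumes "\<And>k. x k \<in> V" "y \<in> V" "(\<lambda>k::nat. N (x k - y)) \<longlonglongrightarrow> 0"
  shows "(\<lambda>k. N (T (x k) - T y)) \<longlonglongrightarrow> 0"
proof -
  obtain B where B: "B > 0" "\<And>x. x \<in> V \<Longrightarrow> N (T x) \<le> B * N x" by (rule T_bounded) blast
  show ?thesis
  proof (rule tendsto_sandwich[OF _ _ tendsto_const])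
    show "\<forall>\<^sub>F k in sequentially. N (T (x k) - T y) \<le> B * N (x k - y)"
      using B(2) assms by (auto simp: T_diff[symmetric])
    show "(\<lambda>k. B * N (x k - y)) \<longlonglongrightarrow> 0" using tendsto_mult_right_zero[OF assms(3)] .
  qed (simp add: N_nonneg)
qed

end

section \<open>Riesz theory: an injective \<open>T - c\<close> with nonzero \<open>c\<close> is
  onto\<close>

locale compact_perturbation = compact_operator scale V N T
  for scale :: "'a::real_normed_field \<Rightarrow> 'b::ab_group_add \<Rightarrow> 'b" (infixr \<open>*s\<close> 75)
    and V N T +
  fixes c :: 'a
  assumes c_nonzero: "c \<noteq> 0"
    and inj: "inj_on (\<lambda>x. T x - c *s x) V"
begin

definition S :: "'b \<Rightarrow> 'b" where "S x = T x - c *s x"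

lemma S_in_V [simp, intro]: "x \<in> V \<Longrightarrow> S x \<in> V"
  by (auto simp: S_def)

lemma S_add: "x \<in> V \<Longrightarrow> y \<in> V \<Longrightarrow> S (x + y) = S x + S y"
  by (simp add: S_def T_add scale_right_distrib)

lemma S_diff: "x \<in> V \<Longrightarrow> y \<in> V \<Longrightarrow> S (x - y) = S x - S y"
  by (simp add: S_def T_diff scale_right_diff_distrib)

lemma S_scale: "x \<in> V \<Longrightarrow> S (a *s x) = a *s S x"
  by (simp add: S_def T_scale scale_right_diff_distrib mult.commute)

lemma S_inj: "inj_on S V"
  using inj by (simp add: S_def[abs_def])

lemma S_zeroD: "x \<in> V \<Longrightarrow> S x = 0 \<Longrightarrow> x = 0"
  using S_inj S_diff[of 0 0] by (auto dest: inj_onD[of S V x 0])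

text \<open>A bounded sequence whose images under \<open>T - c\<close> converge has a convergent subsequence,
  because \<open>c x = T x - (T - c) x\<close>.\<close>

lemma S_preimage_subseq:
  assumes x: "\<And>k::nat. x k \<in> V" "\<And>k. N (x k) \<le> B"
    and y: "y \<in> V" "(\<lambda>k. N (S (x k) - y)) \<longlonglongrightarrow> 0"
  obtains r f where "strict_mono r" "f \<in> V" "(\<lambda>k. N (x (r k) - f)) \<longlonglongrightarrow> 0" "S f = y"
proof -
  obtain r g where r: "strict_mono r" "g \<in> V" "(\<lambda>k. N (T (x (r k)) - g)) \<longlonglongrightarrow> 0"
    using T_compact[of x B] x by auto
  \<comment> \<open>Passing to the limit in \<open>c x = T x - S x\<close> leaves only this
    candidate for the limit of \<open>x (r k)\<close>.\<close>
  define f where "f = inverse c *s (g - y)"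
  have f: "f \<in> V" unfolding f_def using r y by auto
  have y': "(\<lambda>k. N (S (x (r k)) - y)) \<longlonglongrightarrow> 0"
    using LIMSEQ_subseq_LIMSEQ[OF y(2) r(1)] by (simp add: o_def)
  have lim: "(\<lambda>k. N (x (r k) - f)) \<longlonglongrightarrow> 0"
  proof (rule tendsto_sandwich[OF _ _ tendsto_const])
    show "(\<lambda>k. norm (inverse c) * (N (T (x (r k)) - g) + N (S (x (r k)) - y))) \<longlonglongrightarrow> 0"
      using tendsto_mult_right_zero[OF tendsto_add[OF r(3) y', simplified]] by simp
    have "N (x (r k) - f) \<le> norm (inverse c) * (N (T (x (r k)) - g) + N (S (x (r k)) - y))" for k
    proof -
      have "x (r k) - f = inverse c *s ((T (x (r k)) - g) - (S (x (r k)) - y))"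
        using c_nonzero by (simp add: f_def S_def scale_right_diff_distrib)
      then have "N (x (r k) - f) = norm (inverse c) * N ((T (x (r k)) - g) - (S (x (r k)) - y))"
        using x r y by (simp add: N_scale)
      also have "\<dots> \<le> norm (inverse c) * (N (T (x (r k)) - g) + N (S (x (r k)) - y))"
        using x r y by (intro mult_left_mono N_diff_le) auto
      finally show ?thesis .
    qed
    then show "\<forall>\<^sub>F k in sequentially. N (x (r k) - f)
        \<le> norm (inverse c) * (N (T (x (r k)) - g) + N (S (x (r k)) - y))" by simp
  qed (simp add: N_nonneg)
  have "(\<lambda>k. N (T (x (r k)) - T f) + norm c * N (x (r k) - f)) \<longlonglongrightarrow> 0"
    using tendsto_add[OF T_lim[OF x(1) f lim] tendsto_mult_right_zero[OF lim]] by simp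
  with y' have "(\<lambda>k. N (S (x (r k)) - y)
      + (N (T (x (r k)) - T f) + norm c * N (x (r k) - f))) \<longlonglongrightarrow> 0 + 0"
    by (rule tendsto_add)
  \<comment> \<open>This is the continuity of \<open>S\<close>: the left side does not depend on
    \<open>k\<close>, while the right side tends to 0.\<close>
  moreover have "N (S f - y) \<le> N (S (x (r k)) - y)
      + (N (T (x (r k)) - T f) + norm c * N (x (r k) - f))" for k
  proof -
    have "N (S f - y) \<le> N (S f - S (x (r k))) + N (S (x (r k)) - y)"
      using N_triangle_diff f x y by auto
    also have "N (S f - S (x (r k))) = N ((T (x (r k)) - T f) - c *s (x (r k) - f))"
      using f x by (subst N_minus_commute) (auto simp: S_def scale_right_diff_distrib algebra_simps)
    also have "\<dots> \<le> N (T (x (r k)) - T f) + N (c *s (x (r k) - f))"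
      using f x by (intro N_diff_le) auto
    finally show ?thesis using f x by (simp add: N_scale)
  qed
  ultimately have "N (S f - y) \<le> 0 + 0"
    by (intro LIMSEQ_le_const) blast+
  then have "S f = y" using N_zeroD[of "S f - y"] N_nonneg[of "S f - y"] f y by auto
  with r f lim show thesis by (intro that)
qed

text \<open>Unit vectors with \<open>S (y k)\<close> tending to 0 would have a subsequence
  converging to some \<open>f\<close> with \<open>S f = 0\<close>. Injectivity gives
  \<open>f = 0\<close>, against the unit norms.\<close>

lemma S_bounded_below:
  obtains \<delta> where "\<delta> > 0" "\<And>x. x \<in> V \<Longrightarrow> \<delta> * N x \<le> N (S x)"
proof -
  have "\<exists>\<delta>>0. \<forall>x\<in>V. \<delta> * N x \<le> N (S x)"
  proof (rule ccontr)
    assume "\<not> ?thesis"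
    then have "\<exists>x\<in>V. inverse (real (Suc k)) * N x > N (S x)" for k
      by (metis inverse_positive_iff_positive not_le of_nat_0_less_iff zero_less_Suc)
    then obtain x where x: "\<And>k. x k \<in> V" "\<And>k. inverse (real (Suc k)) * N (x k) > N (S (x k))"
      by metis
    have x0: "x k \<noteq> 0" for k using x(2)[of k] N_nonneg[of "S (x k)"] by auto
    define y where "y k = of_real (inverse (N (x k))) *s x k" for k
    have y: "y k \<in> V" "N (y k) = 1" for k
      unfolding y_def using x(1) x0 N_normalize by auto
    have Sy: "N (S (y k)) \<le> inverse (real (Suc k))" for k
      using x(2)[of k] N_pos[OF x(1) x0, of k] x(1)
      by (simp add: y_def S_scale N_scale norm_inverse) (simp add: field_simps)
    have lim: "(\<lambda>k. N (S (y k) - 0)) \<longlonglongrightarrow> 0"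
      by (rule tendsto_sandwich[OF _ _ tendsto_const LIMSEQ_inverse_real_of_nat])
        (use Sy in \<open>auto simp: N_nonneg\<close>)
    obtain r f where r: "strict_mono r" "f \<in> V" "(\<lambda>k. N (y (r k) - f)) \<longlonglongrightarrow> 0" "S f = 0"
      by (rule S_preimage_subseq[OF y(1) eq_refl[OF y(2)] V_closed(1) lim])
    have "f = 0" using S_zeroD r by blast
    with r(3) y(2) show False by (simp add: LIMSEQ_const_iff)
  qed
  then show thesis using that by blast
qed

text \<open>The lower bound for \<open>S\<close> keeps the preimages of a convergent sequence
  bounded, so a subsequence of them converges, and its limit stays in \<open>W\<close>.\<close>

lemma S_image_closed:
  assumes W: "W \<subseteq> V" "N_closed W"
  shows "N_closed (S ` W)"
  unfolding N_closed_def
proof (intro allI impI, elim conjE)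
  fix z y assume z: "\<forall>k::nat. z k \<in> S ` W" and y: "y \<in> V" and lim: "(\<lambda>k. N (z k - y)) \<longlonglongrightarrow> 0"
  have "\<forall>k. \<exists>x. x \<in> W \<and> z k = S x" using z by blast
  then obtain x where x: "\<And>k. x k \<in> W" "\<And>k. z k = S (x k)" by metis
  have xV: "x k \<in> V" for k using x W by auto
  obtain \<delta> where d: "\<delta> > 0" "\<And>x. x \<in> V \<Longrightarrow> \<delta> * N x \<le> N (S x)" by (rule S_bounded_below) blast
  obtain K where K: "\<forall>k. norm (N (z k - y)) \<le> K"
    using convergent_imp_Bseq[OF convergentI[OF lim]] unfolding Bseq_def by blast
  have "N (x k) \<le> (K + N y) / \<delta>" for k
  proof -
    have "\<delta> * N (x k) \<le> N (z k)" using d xV x by simp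
    also have "\<dots> \<le> N (z k - y) + N y" using N_le_diff xV y by (simp add: x)
    also have "\<dots> \<le> K + N y" using K[rule_format, of k] by (simp add: N_nonneg)
    finally show ?thesis using d by (simp add: field_simps)
  qed
  note bd = this
  have Slim: "(\<lambda>k. N (S (x k) - y)) \<longlonglongrightarrow> 0" using lim by (simp add: x)
  obtain r f where f: "strict_mono r" "f \<in> V" "(\<lambda>k. N (x (r k) - f)) \<longlonglongrightarrow> 0" "S f = y"
    by (rule S_preimage_subseq[OF xV bd y Slim])
  have "f \<in> W" using W(2) f(2,3) x(1) unfolding N_closed_def
    by (elim allE[of _ "\<lambda>k. x (r k)"] allE[of _ f]) simp
  then show "y \<in> S ` W" using f by auto
qed

lemma S_image_subspace:
  assumes "subspace W" "W \<subseteq> V"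
  shows "subspace (S ` W)"
proof -
  have "S 0 = 0" using S_diff[of 0 0] by simp
  moreover have "S x + S y \<in> S ` W" if "x \<in> W" "y \<in> W" for x y
    using that assms S_add[of x y] subspace_add[of W x y] by (metis image_eqI subsetD)
  moreover have "a *s S x \<in> S ` W" if "x \<in> W" for a x
    using that assms S_scale[of x a] subspace_scale[of W x a] by (metis image_eqI subsetD)
  ultimately show ?thesis using subspace_0[OF assms(1)]
    by (auto simp: subspace_def image_iff)
qed

text \<open>The ranges of the powers of \<open>S\<close> form a decreasing chain of closed
  subspaces, strictly decreasing if \<open>S\<close> is not onto.\<close>

abbreviation R :: "nat \<Rightarrow> 'b set" where "R k \<equiv> (S ^^ k) ` V"

lemma R_Suc: "R (Suc k) = S ` R k"
  by (simp add: image_comp)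

text \<open>Peeling off the innermost \<open>S\<close> gives monotonicity and strictness of the
  chain; peeling off the outermost, as in \<open>R_Suc\<close>, suits the inductions on subspaces
  and closedness.\<close>

lemma R_Suc': "R (Suc k) = (S ^^ k) ` (S ` V)"
  by (simp only: funpow_Suc_right image_comp)

lemma R_subset_V: "R k \<subseteq> V"
proof (induction k)
  case (Suc k)
  then show ?case unfolding R_Suc by blast
qed simp

lemma R_Suc_subset: "R (Suc k) \<subseteq> R k"
  unfolding R_Suc' by (intro image_mono) auto

lemma R_antimono: "k \<le> l \<Longrightarrow> R l \<subseteq> R k"
  by (rule lift_Suc_antimono_le[of R]) (rule R_Suc_subset)

lemma subspace_R: "subspace (R k)"
proof (induction k)
  case 0
  show ?case using subspace_V by simp
next
  case (Suc k)
  show ?case unfolding R_Suc by (rule S_image_subspace[OF Suc R_subset_V])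
qed

lemma R_closed: "N_closed (R k)"
proof (induction k)
  case 0
  show ?case by (simp add: N_closed_def)
next
  case (Suc k)
  show ?case unfolding R_Suc by (rule S_image_closed[OF R_subset_V Suc])
qed

lemma S_pow_inj: "inj_on (S ^^ k) V"
proof (induction k)
  case (Suc k)
  have "inj_on (S \<circ> S ^^ k) V"
    using Suc inj_on_subset[OF S_inj R_subset_V] by (rule comp_inj_on)
  then show ?case by (simp add: comp_def)
qed simp

text \<open>If \<open>S\<close> is not onto, injectivity of the powers makes every inclusion in the
  chain strict. The Riesz lemma then gives unit vectors \<open>u k\<close> whose images under
  \<open>T\<close> stay \<open>norm c / 2\<close> apart, so no subsequence of the images
  converges.\<close>

theorem S_surj: "S ` V = V"
proof (rule ccontr)
  assume neq: "S ` V \<noteq> V"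
  have sub: "R (Suc k) \<subset> R k" for k
  proof -
    obtain x where x: "x \<in> V" "x \<notin> S ` V" using neq by auto
    then have "(S ^^ k) x \<notin> (S ^^ k) ` (S ` V)"
      using inj_on_image_mem_iff[OF S_pow_inj x(1), of "S ` V"] by blast
    with x have "(S ^^ k) x \<in> R k - R (Suc k)" unfolding R_Suc' by blast
    then show ?thesis using R_Suc_subset by blast
  qed
  have "\<exists>u. u \<in> R k \<and> N u = 1 \<and> (\<forall>v\<in>R (Suc k). 1 / 2 \<le> N (u - v))" for k
    by (rule riesz_lemma[OF subspace_R R_subset_V subspace_R sub R_closed]) blast
  then obtain u where u: "\<And>k. u k \<in> R k" "\<And>k. N (u k) = 1"
    "\<And>k v. v \<in> R (Suc k) \<Longrightarrow> 1 / 2 \<le> N (u k - v)"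
    by metis
  have uV: "u k \<in> V" for k using u(1) R_subset_V by blast
  have sep: "norm c / 2 \<le> N (T (u k) - T (u l))" if "k < l" for k l
  proof -
    \<comment> \<open>Chosen so that \<open>T (u k) - T (u l) = c (u k - v)\<close>. All three
      ingredients lie in \<open>R (Suc k)\<close> because \<open>k < l\<close>, so the Riesz bound
      applies to \<open>v\<close>.\<close>
    define v where "v = u l + inverse c *s (S (u l) - S (u k))"
    have "u l \<in> R (Suc k)" using u(1)[of l] R_antimono[of "Suc k" l] that by auto
    moreover have "S (u k) \<in> R (Suc k)" using u(1) unfolding R_Suc by blast
    moreover have "S (u l) \<in> R (Suc k)"
      using u(1)[of l] R_antimono[of k l] that unfolding R_Suc by (meson image_eqI less_imp_le subsetD)
    ultimately have v: "v \<in> R (Suc k)" unfolding v_def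
      by (intro subspace_add subspace_scale subspace_diff subspace_R)
    have "T (u k) - T (u l) = c *s (u k - v)"
      using c_nonzero by (simp add: v_def S_def scale_right_diff_distrib scale_right_distrib)
    moreover have "u k - v \<in> V" using uV v R_subset_V[of "Suc k"] by blast
    ultimately have "N (T (u k) - T (u l)) = norm c * N (u k - v)"
      by (simp only: N_scale)
    moreover have "norm c * (1 / 2) \<le> norm c * N (u k - v)"
      using u(3)[OF v] by (intro mult_left_mono) auto
    ultimately show ?thesis by simp
  qed
  obtain r g where r: "strict_mono r" "g \<in> V" "(\<lambda>k. N (T (u (r k)) - g)) \<longlonglongrightarrow> 0"
    using T_compact[of u 1] uV u(2) by auto
  have "\<forall>\<^sub>F k in sequentially. N (T (u (r k)) - g) < norm c / 4"
    using c_nonzero by (intro order_tendstoD(2)[OF r(3)]) simp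
  then obtain k where k: "\<And>l. l \<ge> k \<Longrightarrow> N (T (u (r l)) - g) < norm c / 4"
    unfolding eventually_sequentially by blast
  \<comment> \<open>Two terms of the convergent subsequence, each within a quarter of
    \<open>norm c\<close> of the limit, are too close to each other.\<close>
  have "norm c / 2 \<le> N (T (u (r k)) - T (u (r (Suc k))))"
    using r(1) by (intro sep) (simp add: strict_mono_def)
  also have "\<dots> \<le> N (T (u (r k)) - g) + N (g - T (u (r (Suc k))))"
    using uV r by (intro N_triangle_diff) auto
  also have "\<dots> < norm c / 4 + norm c / 4"
    using k[of k] k[of "Suc k"] uV r by (subst N_minus_commute) (auto intro: add_strict_mono)
  finally show False by simp
qed

end

theorem (in compact_operator) fredholm_alternative:
  assumes "c \<noteq> 0" "\<And>x. x \<in> V \<Longrightarrow> T x = c *s x \<Longrightarrow> x = 0"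
  shows "bij_betw (\<lambda>x. T x - c *s x) V V"
proof -
  have "inj_on (\<lambda>x. T x - c *s x) V"
  proof (rule inj_onI)
    fix x y assume xy: "x \<in> V" "y \<in> V" "T x - c *s x = T y - c *s y"
    then have "T (x - y) = c *s (x - y)"
      by (simp add: T_diff scale_right_diff_distrib algebra_simps)
    then show "x = y" using assms(2)[of "x - y"] xy by simp
  qed
  then interpret compact_perturbation scale V N T c
    using assms(1) by unfold_locales
  show ?thesis using S_inj S_surj by (simp add: bij_betw_def S_def[abs_def])
qed

section \<open>The norm of the weighted Bergman and Hardy spaces\<close>

text \<open>Young's inequality, from the square of \<open>e * cmod a - cmod b\<close>. The parameter
  \<open>e\<close> stays free: it survives integration and suprema, and a good choice afterwards
  recovers the triangle inequality for the norm.\<close>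

lemma cmod_add_power2_le:
  assumes "0 < e"
  shows "(cmod (a + b))\<^sup>2 \<le> (1 + e) * (cmod a)\<^sup>2 + (1 + 1 / e) * (cmod b)\<^sup>2"
proof -
  have "(cmod (a + b))\<^sup>2 \<le> (cmod a + cmod b)\<^sup>2"
    by (intro power_mono norm_triangle_ineq) auto
  also have "\<dots> \<le> (1 + e) * (cmod a)\<^sup>2 + (1 + 1 / e) * (cmod b)\<^sup>2"
  proof -
    have "0 \<le> (e * cmod a - cmod b)\<^sup>2 / e" using assms by simp
    also have "\<dots> = e * (cmod a)\<^sup>2 + 1 / e * (cmod b)\<^sup>2 - 2 * cmod a * cmod b"
      using assms by (simp add: power2_eq_square field_simps)
    finally show ?thesis by (simp add: power2_sum algebra_simps)
  qed
  finally show ?thesis .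
qed

lemma nn_integral_power2_add_le:
  fixes u v :: "'a \<Rightarrow> complex" and \<omega> :: "'a \<Rightarrow> real"
  assumes [measurable]: "u \<in> borel_measurable M" "v \<in> borel_measurable M" "\<omega> \<in> borel_measurable M"
    and \<omega>: "\<And>x. 0 \<le> \<omega> x" and e: "0 < e"
  shows "(\<integral>\<^sup>+x. ennreal ((cmod (u x + v x))\<^sup>2 * \<omega> x) \<partial>M) \<le>
    ennreal (1 + e) * (\<integral>\<^sup>+x. ennreal ((cmod (u x))\<^sup>2 * \<omega> x) \<partial>M) +
    ennreal (1 + 1 / e) * (\<integral>\<^sup>+x. ennreal ((cmod (v x))\<^sup>2 * \<omega> x) \<partial>M)"
proof -
  have "ennreal ((cmod (u x + v x))\<^sup>2 * \<omega> x) \<le> ennreal (1 + e) * ennreal ((cmod (u x))\<^sup>2 * \<omega> x) +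
      ennreal (1 + 1 / e) * ennreal ((cmod (v x))\<^sup>2 * \<omega> x)" for x
  proof -
    have "(cmod (u x + v x))\<^sup>2 * \<omega> x \<le>
        ((1 + e) * (cmod (u x))\<^sup>2 + (1 + 1 / e) * (cmod (v x))\<^sup>2) * \<omega> x"
      by (intro mult_right_mono cmod_add_power2_le \<omega> e)
    also have "\<dots> = (1 + e) * ((cmod (u x))\<^sup>2 * \<omega> x) + (1 + 1 / e) * ((cmod (v x))\<^sup>2 * \<omega> x)"
      by (simp add: algebra_simps)
    finally show ?thesis
      using e \<omega>[of x] by (simp flip: ennreal_mult ennreal_plus add: ennreal_leI)
  qed
  then have "(\<integral>\<^sup>+x. ennreal ((cmod (u x + v x))\<^sup>2 * \<omega> x) \<partial>M) \<le>
      (\<integral>\<^sup>+x. ennreal (1 + e) * ennreal ((cmod (u x))\<^sup>2 * \<omega> x) +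
         ennreal (1 + 1 / e) * ennreal ((cmod (v x))\<^sup>2 * \<omega> x) \<partial>M)"
    by (intro nn_integral_mono)
  also have "\<dots> = ennreal (1 + e) * (\<integral>\<^sup>+x. ennreal ((cmod (u x))\<^sup>2 * \<omega> x) \<partial>M) +
      ennreal (1 + 1 / e) * (\<integral>\<^sup>+x. ennreal ((cmod (v x))\<^sup>2 * \<omega> x) \<partial>M)"
    by (simp add: nn_integral_add nn_integral_cmult)
  finally show ?thesis .
qed

text \<open>The points of \<open>U\<close> where \<open>h\<close> is nonzero form a set that is open
  and negligible, hence empty.\<close>

lemma AE_zero_imp_zero_on_open:
  fixes h :: "'a::euclidean_space \<Rightarrow> 'b::{t1_space, zero}"
  assumes "open U" "continuous_on U h" "AE x in lborel. x \<in> U \<longrightarrow> h x = 0" "x \<in> U"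
  shows "h x = 0"
proof -
  let ?W = "U \<inter> h -` (- {0})"
  have "open ?W"
    using assms(1,2) by (intro continuous_open_preimage) auto
  moreover have "negligible ?W"
  proof -
    obtain Z where Z: "{x. \<not> (x \<in> U \<longrightarrow> h x = 0)} \<subseteq> Z" "Z \<in> null_sets lborel"
      using assms(3) by (auto simp: eventually_ae_filter)
    then have "negligible Z"
      by (simp add: negligible_iff_null_sets null_sets_completion_iff null_sets_completionI)
    then show ?thesis using Z(1) by (auto intro: negligible_subset)
  qed
  ultimately have "?W = {}" using open_not_negligible by blast
  then show ?thesis using assms(4) by blast
qed

section \<open>Both norms as weighted square integrals, and their definiteness\<close>

definition bergman_weight :: "real \<Rightarrow> complex \<Rightarrow> real" where
  "bergman_weight \<alpha> z = (\<alpha> + 1) * (1 - (cmod z)\<^sup>2) powr \<alpha> / pi"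

lemma bergman_weight_nonneg: "\<alpha> \<ge> -1 \<Longrightarrow> 0 \<le> bergman_weight \<alpha> z"
  by (simp add: bergman_weight_def)

lemma bergman_weight_measurable [measurable]: "bergman_weight \<alpha> \<in> borel_measurable borel"
  unfolding bergman_weight_def by measurable

text \<open>Moving the indicator inside the square gives an integrand made from a globally
  measurable function, although \<open>f\<close> is controlled only on the disk.
  \<open>Hnorm2_bergman\<close> does the same for the area integral.\<close>

lemma Hnorm2_hardy:
  "Hnorm2 (-1) f = (SUP r\<in>{0<..<1::real}. \<integral>\<^sup>+ t.
     ennreal ((cmod (indicator {0..2*pi} t *\<^sub>R f (complex_of_real r * cis t)))\<^sup>2 * (1 / (2*pi))) \<partial>lborel)"
  unfolding Hnorm2_def
  by (auto intro!: SUP_cong nn_integral_cong simp: indicator_def)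

lemma Hnorm2_bergman:
  assumes "\<alpha> \<noteq> -1"
  shows "Hnorm2 \<alpha> f = (\<integral>\<^sup>+ z. ennreal ((cmod (indicator (ball 0 1) z *\<^sub>R f z))\<^sup>2 * bergman_weight \<alpha> z) \<partial>lborel)"
  using assms unfolding Hnorm2_def bergman_weight_def
  by (auto intro!: nn_integral_cong simp: indicator_def mult.assoc)

lemma circle_measurable:
  assumes "f holomorphic_on ball 0 1" "0 < r" "r < 1"
  shows "(\<lambda>t. indicator {0..2*pi} t *\<^sub>R f (complex_of_real r * cis t)) \<in> borel_measurable lborel"
proof -
  have "continuous_on {0..2*pi} (\<lambda>t. f (complex_of_real r * cis t))"
    using assms by (intro continuous_on_compose2[OF holomorphic_on_imp_continuous_on[OF assms(1)]]
        continuous_intros) (auto simp: norm_mult)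
  then show ?thesis
    using borel_measurable_continuous_on_indicator[of "{0..2*pi}"] by simp
qed

lemma disk_measurable:
  assumes "f holomorphic_on ball 0 1"
  shows "(\<lambda>z. indicator (ball 0 1) z *\<^sub>R f z) \<in> borel_measurable lborel"
  using borel_measurable_continuous_on_indicator[of "ball 0 1" f] assms
  by (simp add: holomorphic_on_imp_continuous_on)

lemma Hnorm2_add_le:
  assumes \<alpha>: "\<alpha> \<ge> -1" and fg: "f holomorphic_on ball 0 1" "g holomorphic_on ball 0 1" and e: "0 < e"
  shows "Hnorm2 \<alpha> (\<lambda>z. f z + g z) \<le>
    ennreal (1 + e) * Hnorm2 \<alpha> f + ennreal (1 + 1 / e) * Hnorm2 \<alpha> g"
proof (cases "\<alpha> = -1")
  case True
  let ?I = "\<lambda>f r. \<integral>\<^sup>+ t. ennreal ((cmod (indicator {0..2*pi} t *\<^sub>R f (complex_of_real r * cis t)))\<^sup>2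
    * (1 / (2*pi))) \<partial>lborel"
  have "?I (\<lambda>z. f z + g z) r \<le> ennreal (1 + e) * Hnorm2 (-1) f + ennreal (1 + 1 / e) * Hnorm2 (-1) g"
    if r: "0 < r" "r < 1" for r
  proof -
    have "?I (\<lambda>z. f z + g z) r \<le> ennreal (1 + e) * ?I f r + ennreal (1 + 1 / e) * ?I g r"
      unfolding scaleR_add_right using r e fg
      by (intro nn_integral_power2_add_le circle_measurable) auto
    also have "\<dots> \<le> ennreal (1 + e) * Hnorm2 (-1) f + ennreal (1 + 1 / e) * Hnorm2 (-1) g"
      unfolding Hnorm2_hardy using r by (intro add_mono mult_left_mono SUP_upper) auto
    finally show ?thesis .
  qed
  then show ?thesis unfolding True Hnorm2_hardy[of "\<lambda>z. f z + g z"]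
    by (intro SUP_least) auto
next
  case False
  show ?thesis unfolding Hnorm2_bergman[OF False] scaleR_add_right
    using \<alpha> e fg by (intro nn_integral_power2_add_le disk_measurable bergman_weight_nonneg) auto
qed

lemma Hnorm2_scale:
  assumes "f holomorphic_on ball 0 1"
  shows "Hnorm2 \<alpha> (\<lambda>z. c * f z) = ennreal ((cmod c)\<^sup>2) * Hnorm2 \<alpha> f"
proof -
  have *: "ennreal ((cmod (indicator A x *\<^sub>R (c * y)))\<^sup>2 * w) =
      ennreal ((cmod c)\<^sup>2) * ennreal ((cmod (indicator A x *\<^sub>R y))\<^sup>2 * w)" for A x y w
    by (simp add: norm_mult power_mult_distrib ennreal_mult'[symmetric] mult_ac)
  show ?thesis
  proof (cases "\<alpha> = -1")
    case True
    show ?thesis unfolding True Hnorm2_hardy * SUP_mult_left_ennreal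
    proof (intro SUP_cong refl nn_integral_cmult)
      fix r :: real assume "r \<in> {0<..<1}"
      then have [measurable]: "(\<lambda>t. indicator {0..2*pi} t *\<^sub>R f (complex_of_real r * cis t))
          \<in> borel_measurable lborel"
        using circle_measurable[OF assms] by auto
      show "(\<lambda>t. ennreal ((cmod (indicator {0..2*pi} t *\<^sub>R f (complex_of_real r * cis t)))\<^sup>2
          * (1 / (2 * pi)))) \<in> borel_measurable lborel"
        by measurable
    qed
  next
    case False
    have [measurable]: "(\<lambda>z. indicator (ball 0 1) z *\<^sub>R f z) \<in> borel_measurable lborel"
      by (rule disk_measurable[OF assms])
    show ?thesis unfolding Hnorm2_bergman[OF False] *
      by (intro nn_integral_cmult) measurable
  qed
qed

text \<open>In the Hardy case every circle integral vanishes, so \<open>f\<close> vanishes on the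
  circles away from angle 0, and the identity theorem finishes. In the Bergman case the weight is
  positive on the disk, so \<open>f\<close> is zero almost everywhere and by continuity
  everywhere.\<close>

lemma Hnorm2_eq_0D:
  assumes \<alpha>: "\<alpha> \<ge> -1" and f: "f holomorphic_on ball 0 1" and "Hnorm2 \<alpha> f = 0" "z \<in> ball 0 1"
  shows "f z = 0"
proof (cases "\<alpha> = -1")
  case True
  have "f (complex_of_real r * cis t) = 0" if r: "0 < r" "r < 1" and t: "0 < t" "t < 2 * pi" for r t
  proof -
    let ?h = "\<lambda>t. indicator {0..2*pi} t *\<^sub>R f (complex_of_real r * cis t)"
    have [measurable]: "?h \<in> borel_measurable lborel" by (rule circle_measurable[OF f r])
    have "(\<integral>\<^sup>+ t. ennreal ((cmod (?h t))\<^sup>2 * (1 / (2*pi))) \<partial>lborel) \<le> Hnorm2 (-1) f"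
      unfolding Hnorm2_hardy using r by (intro SUP_upper) auto
    then have "(\<integral>\<^sup>+ t. ennreal ((cmod (?h t))\<^sup>2 * (1 / (2*pi))) \<partial>lborel) = 0"
      using assms(3) True by simp
    then have "AE t in lborel. ennreal ((cmod (?h t))\<^sup>2 * (1 / (2*pi))) = 0"
      by (subst (asm) nn_integral_0_iff_AE) measurable
    then have "AE t in lborel. t \<in> {0<..<2*pi} \<longrightarrow> f (complex_of_real r * cis t) = 0"
      by eventually_elim (auto simp: ennreal_eq_0_iff indicator_def divide_le_0_iff split: if_splits)
    moreover have "continuous_on {0<..<2*pi} (\<lambda>t. f (complex_of_real r * cis t))"
      using r by (intro continuous_on_compose2[OF holomorphic_on_imp_continuous_on[OF f]]
          continuous_intros) (auto simp: norm_mult)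
    ultimately show ?thesis
      using AE_zero_imp_zero_on_open[of "{0<..<2*pi}" "\<lambda>t. f (complex_of_real r * cis t)" t] t by auto
  qed
  note zero = this
  \<comment> \<open>The upper half disk is an open set whose points all have an argument strictly
    between 0 and \<open>2 * pi\<close>.\<close>
  have seg: "f u = 0" if u: "u \<in> ball 0 1" "Im u > 0" for u
  proof -
    have "u \<noteq> 0" using u by auto
    then have "0 < Arg2pi u" "Arg2pi u < 2 * pi"
      using u Arg2pi_lt_pi[of u] Arg2pi_lt_2pi[of u] by auto
    moreover have "u = complex_of_real (cmod u) * cis (Arg2pi u)"
      using Arg2pi_eq[of u] by (simp add: is_Arg_def cis_conv_exp)
    ultimately show ?thesis using zero[of "cmod u" "Arg2pi u"] u \<open>u \<noteq> 0\<close> by simp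
  qed
  show ?thesis
  proof (rule analytic_continuation_open[where s = "ball 0 1 \<inter> {u. Im u > 0}" and s' = "ball 0 1"
        and g = "\<lambda>_. 0" and f = f])
    show "open (ball 0 1 \<inter> {u. Im u > 0})" by (intro open_Int open_halfspace_Im_gt) auto
    have "\<i> / 2 \<in> ball 0 1 \<inter> {u. Im u > 0}" by (simp add: norm_divide)
    then show "ball 0 1 \<inter> {u. Im u > 0} \<noteq> {}" by blast
  qed (use f assms(4) seg in auto)
next
  case False
  let ?h = "\<lambda>z. indicator (ball 0 1) z *\<^sub>R f z"
  have [measurable]: "?h \<in> borel_measurable lborel" by (rule disk_measurable[OF f])
  have "AE z in lborel. ennreal ((cmod (?h z))\<^sup>2 * bergman_weight \<alpha> z) = 0"
    using assms(3) unfolding Hnorm2_bergman[OF False]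
    by (subst (asm) nn_integral_0_iff_AE) measurable
  then have "AE z in lborel. z \<in> ball 0 1 \<longrightarrow> f z = 0"
  proof eventually_elim
    case (elim z)
    show ?case
    proof
      assume z: "z \<in> ball 0 1"
      then have "(cmod z)\<^sup>2 < 1" by (simp add: power_less_one_iff abs_square_less_1)
      then have "bergman_weight \<alpha> z > 0"
        using \<alpha> False by (simp add: bergman_weight_def)
      with elim z show "f z = 0" by (simp add: ennreal_eq_0_iff mult_le_0_iff)
    qed
  qed
  then show ?thesis
    using AE_zero_imp_zero_on_open[of "ball 0 1" f z] assms(4)
      holomorphic_on_imp_continuous_on[OF f] by auto
qed

section \<open>Finite total mass and membership of bounded functions\<close>

lemma dyadic_bracket:
  fixes t :: real
  assumes "0 < t" "t \<le> 1"
  obtains k where "(1 / 2) ^ Suc k < t" "t \<le> (1 / 2) ^ k"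
proof -
  obtain m where m: "(1 / 2 :: real) ^ m < t"
    using real_arch_pow_inv[of t "1 / 2"] assms by auto
  define k where "k = (LEAST k. (1 / 2 :: real) ^ Suc k < t)"
  have "(1 / 2 :: real) ^ Suc m \<le> (1 / 2) ^ m" by (intro power_decreasing) auto
  with m have "(1 / 2 :: real) ^ Suc m < t" by linarith
  then have "(1 / 2) ^ Suc k < t" unfolding k_def by (rule LeastI)
  moreover have "t \<le> (1 / 2) ^ k"
  proof (cases k)
    case (Suc j)
    then show ?thesis using not_less_Least[of j "\<lambda>k. (1 / 2 :: real) ^ Suc k < t"] by (simp add: k_def)
  qed (use assms in simp)
  ultimately show thesis by (rule that)
qed

text \<open>The disk is cut into the dyadic annuli \<open>2^(-k-1) < 1 - |z| \<le> 2^(-k)\<close>, whose areas are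
  \<open>O(2^(-k))\<close>.\<close>

lemma bergman_weight_integrable:
  assumes "\<alpha> > -1"
  shows "(\<integral>\<^sup>+ z. ennreal (indicator (ball 0 1) z * bergman_weight \<alpha> z) \<partial>lborel) < \<infinity>"
proof -
  \<comment> \<open>With this exponent the weight is at most a constant times
    \<open>(1 - cmod z) powr (- \<beta>)\<close> for either sign of \<alpha>, and
    \<open>\<beta> < 1\<close> since \<open>\<alpha> > -1\<close>.\<close>
  define \<beta> where "\<beta> = max 0 (- \<alpha>)"
  have \<beta>: "0 \<le> \<beta>" "\<beta> < 1" using assms by (auto simp: \<beta>_def)
  define C where "C = (\<alpha> + 1) / pi * 2 powr \<beta>"
  have C: "C \<ge> 0" using assms by (simp add: C_def)
  \<comment> \<open>On the \<open>k\<close>-th annulus the weight is at most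
    \<open>C * q ^ k\<close>; as \<open>q < 2\<close>, multiplying by an area of order
    \<open>(1 / 2) ^ k\<close> leaves a convergent geometric series.\<close>
  define q where "q = (2::real) powr \<beta>"
  have q: "q > 0" "q < 2" using \<beta> powr_less_mono[of \<beta> 1 2] by (auto simp: q_def)
  \<comment> \<open>The full outer ring is taken in place of the dyadic annulus it contains. The
    overlaps are harmless for an upper bound.\<close>
  define A where "A k = ball 0 1 - ball (0::complex) (1 - (1 / 2) ^ k)" for k :: nat
  have [measurable]: "A k \<in> sets lborel" for k by (simp add: A_def)
  have bound: "ennreal (indicator (ball 0 1) z * bergman_weight \<alpha> z)
      \<le> (\<Sum>k. ennreal (C * q ^ k) * indicator (A k) z)" for z
  proof (cases "z \<in> ball 0 1")
    case True
    define t where "t = 1 - cmod z"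
    have t: "0 < t" "t \<le> 1" using True by (auto simp: t_def)
    obtain k where k: "(1 / 2) ^ Suc k < t" "t \<le> (1 / 2) ^ k" using dyadic_bracket[OF t] .
    have sq: "t \<le> 1 - (cmod z)\<^sup>2" "1 - (cmod z)\<^sup>2 \<le> 1"
      using True by (auto simp: t_def power2_eq_square intro: mult_left_le_one_le)
    have "(1 - (cmod z)\<^sup>2) powr \<alpha> \<le> t powr (- \<beta>)"
    proof (cases "\<alpha> \<ge> 0")
      case True
      have "(1 - (cmod z)\<^sup>2) powr \<alpha> \<le> 1 powr \<alpha>"
        using True sq t by (intro powr_mono2) auto
      then show ?thesis using True t by (simp add: \<beta>_def max_def)
    next
      case False
      then show ?thesis using sq t by (auto simp: \<beta>_def max_def intro: powr_mono2')
    qed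
    also have "\<dots> \<le> ((1 / 2) ^ Suc k) powr (- \<beta>)"
      using k \<beta> by (intro powr_mono2') auto
    also have "\<dots> = 2 powr \<beta> * q ^ k"
      by (simp add: q_def powr_minus powr_divide powr_mult powr_powr mult.commute
          flip: powr_realpow powr_add)
    finally have "(\<alpha> + 1) / pi * (1 - (cmod z)\<^sup>2) powr \<alpha> \<le> (\<alpha> + 1) / pi * (2 powr \<beta> * q ^ k)"
      using assms by (intro mult_left_mono) auto
    then have "bergman_weight \<alpha> z \<le> C * q ^ k"
      by (simp add: bergman_weight_def C_def)
    moreover have "z \<in> A k" using True k by (auto simp: A_def t_def)
    ultimately have "ennreal (indicator (ball 0 1) z * bergman_weight \<alpha> z)
        \<le> ennreal (C * q ^ k) * indicator (A k) z"
      using True by (simp add: ennreal_leI)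
    also have "\<dots> = (\<Sum>j\<in>{k}. ennreal (C * q ^ j) * indicator (A j) z)"
      by (subst sum.insert; simp)
    also have "\<dots> \<le> (\<Sum>k. ennreal (C * q ^ k) * indicator (A k) z)"
      by (intro sum_le_suminf) auto
    finally show ?thesis .
  qed simp
  have area: "emeasure lborel (A k) \<le> ennreal (2 * pi * (1 / 2) ^ k)" for k
  proof -
    have s: "(1 / 2 :: real) ^ k \<le> 1" by (intro power_le_one) auto
    have "emeasure lborel (A k) =
        emeasure lborel (ball (0::complex) 1) - emeasure lborel (ball (0::complex) (1 - (1 / 2) ^ k))"
      unfolding A_def by (intro emeasure_Diff subset_ball) (auto simp: emeasure_ball s)
    also have "\<dots> = ennreal (pi - pi * (1 - (1 / 2) ^ k)\<^sup>2)"
      using s by (simp add: emeasure_ball unit_ball_vol_2 ennreal_minus)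
    also have "\<dots> \<le> ennreal (2 * pi * (1 / 2) ^ k)"
      by (intro ennreal_leI) (simp add: power2_eq_square algebra_simps)
    finally show ?thesis .
  qed
  have "(\<integral>\<^sup>+ z. ennreal (indicator (ball 0 1) z * bergman_weight \<alpha> z) \<partial>lborel)
      \<le> (\<integral>\<^sup>+ z. (\<Sum>k. ennreal (C * q ^ k) * indicator (A k) z) \<partial>lborel)"
    by (intro nn_integral_mono bound)
  also have "\<dots> = (\<Sum>k. \<integral>\<^sup>+ z. ennreal (C * q ^ k) * indicator (A k) z \<partial>lborel)"
    by (intro nn_integral_suminf) measurable
  also have "\<dots> = (\<Sum>k. ennreal (C * q ^ k) * emeasure lborel (A k))"
    by (intro suminf_cong nn_integral_cmult_indicator) measurable
  also have "\<dots> \<le> (\<Sum>k. ennreal (2 * pi * C * (q / 2) ^ k))"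
  proof (intro suminf_le)
    fix k
    have "ennreal (C * q ^ k) * emeasure lborel (A k) \<le> ennreal (C * q ^ k) * ennreal (2 * pi * (1 / 2) ^ k)"
      by (intro mult_left_mono area) auto
    also have "\<dots> = ennreal (2 * pi * C * (q / 2) ^ k)"
      using C q by (simp add: power_divide mult_ac flip: ennreal_mult)
    finally show "ennreal (C * q ^ k) * emeasure lborel (A k) \<le> ennreal (2 * pi * C * (q / 2) ^ k)" .
  qed auto
  also have "\<dots> < \<infinity>"
  proof -
    have "summable (\<lambda>k. 2 * pi * C * (q / 2) ^ k)"
      using q by (intro summable_mult summable_geometric) auto
    then have "(\<Sum>k. ennreal (2 * pi * C * (q / 2) ^ k)) \<noteq> top"
      using C q by (intro ennreal_suminf_neq_top) auto
    then show ?thesis by (simp add: less_top)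
  qed
  finally show ?thesis .
qed

text \<open>The underlying measure has finite total mass. This puts the zero function and the powers
  of \<open>z - w\<close>, cut off outside the disk, into the space.\<close>

lemma Hnorm2_finite_of_bounded:
  assumes \<alpha>: "\<alpha> \<ge> -1" and B: "\<And>z. z \<in> ball 0 1 \<Longrightarrow> cmod (f z) \<le> B"
  shows "Hnorm2 \<alpha> f < \<infinity>"
proof (cases "\<alpha> = -1")
  case True
  have "(\<integral>\<^sup>+ t. ennreal ((cmod (indicator {0..2*pi} t *\<^sub>R f (complex_of_real r * cis t)))\<^sup>2
      * (1 / (2*pi))) \<partial>lborel) \<le> ennreal (B\<^sup>2)" if r: "0 < r" "r < 1" for r
  proof -
    have "(\<integral>\<^sup>+ t. ennreal ((cmod (indicator {0..2*pi} t *\<^sub>R f (complex_of_real r * cis t)))\<^sup>2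
        * (1 / (2*pi))) \<partial>lborel) \<le> (\<integral>\<^sup>+ t. ennreal (B\<^sup>2 / (2*pi)) * indicator {0..2*pi} t \<partial>lborel)"
    proof (intro nn_integral_mono)
      fix t
      have "(cmod (f (complex_of_real r * cis t)))\<^sup>2 \<le> B\<^sup>2"
        using r by (intro power_mono B) (auto simp: norm_mult)
      then show "ennreal ((cmod (indicator {0..2*pi} t *\<^sub>R f (complex_of_real r * cis t)))\<^sup>2
          * (1 / (2*pi))) \<le> ennreal (B\<^sup>2 / (2*pi)) * indicator {0..2*pi} t"
        by (auto simp: indicator_def intro!: ennreal_leI divide_right_mono)
    qed
    also have "\<dots> = ennreal (B\<^sup>2)"
      by (simp add: nn_integral_cmult_indicator flip: ennreal_mult)
    finally show ?thesis .
  qed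
  then have "Hnorm2 \<alpha> f \<le> ennreal (B\<^sup>2)" unfolding True Hnorm2_hardy
    by (intro SUP_least) auto
  then show ?thesis by (simp add: order_le_less_trans)
next
  case False
  have "Hnorm2 \<alpha> f \<le> (\<integral>\<^sup>+ z. ennreal (B\<^sup>2) * ennreal (indicator (ball 0 1) z * bergman_weight \<alpha> z) \<partial>lborel)"
    unfolding Hnorm2_bergman[OF False]
  proof (intro nn_integral_mono)
    fix z
    show "ennreal ((cmod (indicator (ball 0 1) z *\<^sub>R f z))\<^sup>2 * bergman_weight \<alpha> z)
        \<le> ennreal (B\<^sup>2) * ennreal (indicator (ball 0 1) z * bergman_weight \<alpha> z)"
    proof (cases "z \<in> ball 0 1")
      case True
      have "(cmod (f z))\<^sup>2 \<le> B\<^sup>2" using B[OF True] by (intro power_mono) auto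
      then show ?thesis using True bergman_weight_nonneg[OF \<alpha>, of z]
        by (auto simp flip: ennreal_mult intro!: ennreal_leI mult_right_mono)
    qed simp
  qed
  also have "\<dots> = ennreal (B\<^sup>2) * (\<integral>\<^sup>+ z. ennreal (indicator (ball 0 1) z * bergman_weight \<alpha> z) \<partial>lborel)"
  proof (intro nn_integral_cmult)
    have [measurable]: "(\<lambda>z. indicator (ball 0 1) z * bergman_weight \<alpha> z) \<in> borel_measurable lborel"
      by (auto intro!: borel_measurable_times borel_measurable_indicator bergman_weight_measurable)
    show "(\<lambda>z. ennreal (indicator (ball 0 1) z * bergman_weight \<alpha> z)) \<in> borel_measurable lborel"
      by measurable
  qed
  also have "\<dots> < \<infinity>"
    using bergman_weight_integrable[of \<alpha>] \<alpha> False by (simp add: ennreal_mult_less_top)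
  finally show ?thesis .
qed

section \<open>The operator on the Hilbert space\<close>

definition fscale :: "complex \<Rightarrow> (complex \<Rightarrow> complex) \<Rightarrow> complex \<Rightarrow> complex" where
  "fscale c f = (\<lambda>z. c * f z)"

text \<open>Since \<open>enn2real\<close> sends infinity to 0, this is the true norm only on
  \<open>Hspace \<alpha>\<close>; \<open>Hnorm2_eq\<close> is the link.\<close>

definition Hnorm :: "real \<Rightarrow> (complex \<Rightarrow> complex) \<Rightarrow> real" where
  "Hnorm \<alpha> f = sqrt (enn2real (Hnorm2 \<alpha> f))"

lemma HspaceD:
  assumes "f \<in> Hspace \<alpha>"
  shows "f holomorphic_on ball 0 1" "\<And>z. z \<notin> ball 0 1 \<Longrightarrow> f z = 0" "Hnorm2 \<alpha> f < \<infinity>"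
  using assms by (auto simp: Hspace_def)

lemma Hnorm_nonneg: "0 \<le> Hnorm \<alpha> f"
  by (simp add: Hnorm_def)

lemma Hnorm2_eq: "f \<in> Hspace \<alpha> \<Longrightarrow> Hnorm2 \<alpha> f = ennreal ((Hnorm \<alpha> f)\<^sup>2)"
  using HspaceD(3)[of f \<alpha>] by (simp add: Hnorm_def)

lemma Hspace_eq_0I:
  assumes "f \<in> Hspace \<alpha>" "\<And>z. z \<in> ball 0 1 \<Longrightarrow> f z = 0"
  shows "f = 0"
  using HspaceD(2)[OF assms(1)] assms(2) by (fastforce simp: fun_eq_iff)

lemma Hnorm_zeroD:
  assumes "\<alpha> \<ge> -1" "f \<in> Hspace \<alpha>" "Hnorm \<alpha> f = 0"
  shows "f = 0"
proof (rule Hspace_eq_0I[OF assms(2)])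
  show "f z = 0" if "z \<in> ball 0 1" for z
    using Hnorm2_eq_0D[OF assms(1) HspaceD(1)[OF assms(2)] _ that] assms(3)
    by (simp add: Hnorm2_eq[OF assms(2)])
qed

lemma Hspace_add:
  assumes "\<alpha> \<ge> -1" "f \<in> Hspace \<alpha>" "g \<in> Hspace \<alpha>"
  shows "f + g \<in> Hspace \<alpha>"
proof -
  have "Hnorm2 \<alpha> (\<lambda>z. f z + g z) \<le> ennreal (1 + 1) * Hnorm2 \<alpha> f + ennreal (1 + 1 / 1) * Hnorm2 \<alpha> g"
    using assms by (intro Hnorm2_add_le HspaceD(1)) auto
  also have "\<dots> < \<infinity>"
    using HspaceD(3)[OF assms(2)] HspaceD(3)[OF assms(3)] by (simp add: ennreal_mult_less_top)
  finally show ?thesis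
    using assms by (auto simp: Hspace_def plus_fun_def intro!: holomorphic_intros)
qed

lemma Hspace_scale: "f \<in> Hspace \<alpha> \<Longrightarrow> fscale c f \<in> Hspace \<alpha>"
  by (auto simp: Hspace_def fscale_def Hnorm2_scale ennreal_mult_less_top intro!: holomorphic_intros)

lemma Hspace_bounded:
  assumes "\<alpha> \<ge> -1" "f holomorphic_on ball 0 1" "\<And>z. z \<in> ball 0 1 \<Longrightarrow> cmod (f z) \<le> B"
  shows "(\<lambda>z. if z \<in> ball 0 1 then f z else 0) \<in> Hspace \<alpha>"
proof -
  have "(\<lambda>z. if z \<in> ball 0 1 then f z else 0) holomorphic_on ball 0 1"
    using assms(2) by (rule holomorphic_transform) auto
  moreover have "Hnorm2 \<alpha> (\<lambda>z. if z \<in> ball 0 1 then f z else 0) < \<infinity>"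
    using assms by (intro Hnorm2_finite_of_bounded[of _ _ B]) auto
  ultimately show ?thesis by (simp add: Hspace_def)
qed

lemma Hnorm_scale:
  assumes "f \<in> Hspace \<alpha>"
  shows "Hnorm \<alpha> (fscale c f) = cmod c * Hnorm \<alpha> f"
  using Hnorm2_scale[OF HspaceD(1)[OF assms]]
  by (simp add: Hnorm_def fscale_def enn2real_mult real_sqrt_mult)

text \<open>For positive norms \<open>A\<close> and \<open>B\<close>, the choice
  \<open>e = B / A\<close> turns the bound of \<open>Hnorm2_add_le\<close> into exactly
  \<open>(A + B)^2\<close>. Zero norms are split off because the quotient degenerates.\<close>

lemma Hnorm_triangle:
  assumes \<alpha>: "\<alpha> \<ge> -1" and fg: "f \<in> Hspace \<alpha>" "g \<in> Hspace \<alpha>"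
  shows "Hnorm \<alpha> (f + g) \<le> Hnorm \<alpha> f + Hnorm \<alpha> g"
proof (cases "Hnorm \<alpha> f = 0 \<or> Hnorm \<alpha> g = 0")
  case True
  then have "f = 0 \<or> g = 0" using Hnorm_zeroD[OF \<alpha>] fg by blast
  then show ?thesis using Hnorm_nonneg by auto
next
  case False
  define A B where "A = Hnorm \<alpha> f" and "B = Hnorm \<alpha> g"
  have pos: "A > 0" "B > 0"
    using False Hnorm_nonneg[of \<alpha> f] Hnorm_nonneg[of \<alpha> g] by (auto simp: A_def B_def)
  have "ennreal ((Hnorm \<alpha> (f + g))\<^sup>2) = Hnorm2 \<alpha> (\<lambda>z. f z + g z)"
    using Hnorm2_eq[OF Hspace_add[OF \<alpha> fg]] by (simp add: plus_fun_def)
  also have "\<dots> \<le> ennreal (1 + B / A) * Hnorm2 \<alpha> f + ennreal (1 + 1 / (B / A)) * Hnorm2 \<alpha> g"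
    using \<alpha> fg pos by (intro Hnorm2_add_le HspaceD(1)) auto
  also have "\<dots> = ennreal ((1 + B / A) * A\<^sup>2 + (1 + A / B) * B\<^sup>2)"
    using fg pos by (simp add: Hnorm2_eq A_def[symmetric] B_def[symmetric]
        flip: ennreal_mult ennreal_plus)
  also have "(1 + B / A) * A\<^sup>2 + (1 + A / B) * B\<^sup>2 = (A + B)\<^sup>2"
    using pos by (simp add: power2_eq_square field_simps)
  finally have "(Hnorm \<alpha> (f + g))\<^sup>2 \<le> (A + B)\<^sup>2" by (simp add: plus_fun_def)
  then show ?thesis using pos by (auto simp: A_def B_def dest: power2_le_imp_le)
qed

lemma vector_space_fscale: "vector_space fscale"
  by unfold_locales (auto simp: fscale_def fun_eq_iff algebra_simps)

lemma normed_subspace_Hspace: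
  assumes "\<alpha> \<ge> -1"
  shows "normed_subspace fscale (Hspace \<alpha>) (Hnorm \<alpha>)"
proof -
  interpret vector_space fscale by (rule vector_space_fscale)
  have "0 \<in> Hspace \<alpha>"
    using Hspace_bounded[OF assms, of "\<lambda>_. 0" 0] by (simp add: zero_fun_def)
  then show ?thesis
    using assms
    by unfold_locales (auto simp: subspace_def intro: Hspace_add Hspace_scale Hnorm_nonneg
        Hnorm_triangle Hnorm_scale Hnorm_zeroD)
qed

text \<open>Transfers compactness from the extended squared norm to the real norm: bounds are
  squared, and convergence to 0 passes through \<open>enn2real\<close> and
  \<open>sqrt\<close>.\<close>

lemma compact_operator_Hspace:
  assumes \<alpha>: "\<alpha> \<ge> -1" and T: "Hcompact_op \<alpha> T"
    and add: "\<And>f g. f \<in> Hspace \<alpha> \<Longrightarrow> g \<in> Hspace \<alpha> \<Longrightarrow> T (f + g) = T f + T g"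
    and scale: "\<And>c f. f \<in> Hspace \<alpha> \<Longrightarrow> T (fscale c f) = fscale c (T f)"
  shows "compact_operator fscale (Hspace \<alpha>) (Hnorm \<alpha>) T"
proof -
  interpret normed_subspace fscale "Hspace \<alpha>" "Hnorm \<alpha>"
    by (rule normed_subspace_Hspace[OF \<alpha>])
  have TV: "T f \<in> Hspace \<alpha>" if "f \<in> Hspace \<alpha>" for f
    using T that by (simp add: Hcompact_op_def)
  show ?thesis
  proof unfold_locales
    fix x :: "nat \<Rightarrow> complex \<Rightarrow> complex" and B
    assume x: "\<And>k. x k \<in> Hspace \<alpha>" "\<And>k. Hnorm \<alpha> (x k) \<le> B"
    have "Hnorm2 \<alpha> (x k) \<le> ennreal (B\<^sup>2)" for k
      unfolding Hnorm2_eq[OF x(1)] using x(2)[of k] Hnorm_nonneg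
      by (intro ennreal_leI power_mono) auto
    then obtain r g where r: "strict_mono r" "g \<in> Hspace \<alpha>"
      and lim: "(\<lambda>k. Hnorm2 \<alpha> (\<lambda>z. T (x (r k)) z - g z)) \<longlonglongrightarrow> 0"
      using T x(1) unfolding Hcompact_op_def by meson
    have "(\<lambda>k. sqrt (enn2real (Hnorm2 \<alpha> (\<lambda>z. T (x (r k)) z - g z)))) \<longlonglongrightarrow> sqrt 0"
      using lim by (intro tendsto_real_sqrt tendsto_enn2real) auto
    then have "(\<lambda>k. Hnorm \<alpha> (T (x (r k)) - g)) \<longlonglongrightarrow> 0"
      by (simp add: Hnorm_def fun_diff_def)
    with r show "\<exists>r g. strict_mono r \<and> g \<in> Hspace \<alpha> \<and> (\<lambda>k. Hnorm \<alpha> (T (x (r k)) - g)) \<longlonglongrightarrow> 0"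
      by blast
  qed (use TV add scale in auto)
qed

lemma compact_operator_Dop:
  assumes \<alpha>: "\<alpha> \<ge> -1" and T: "Hcompact_op \<alpha> (Dop \<psi> \<phi> n)"
    and \<phi>: "\<phi> ` ball 0 1 \<subseteq> ball 0 1"
  shows "compact_operator fscale (Hspace \<alpha>) (Hnorm \<alpha>) (Dop \<psi> \<phi> n)"
proof (rule compact_operator_Hspace[OF \<alpha> T])
  have in_disk: "\<phi> z \<in> ball 0 1" if "z \<in> ball 0 1" for z using \<phi> that by blast
  show "Dop \<psi> \<phi> n (f + g) = Dop \<psi> \<phi> n f + Dop \<psi> \<phi> n g"
    if "f \<in> Hspace \<alpha>" "g \<in> Hspace \<alpha>" for f g
  proof
    fix z
    show "Dop \<psi> \<phi> n (f + g) z = (Dop \<psi> \<phi> n f + Dop \<psi> \<phi> n g) z"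
    proof (cases "z \<in> ball 0 1")
      case True
      have "(deriv ^^ n) (\<lambda>z. f z + g z) (\<phi> z) = (deriv ^^ n) f (\<phi> z) + (deriv ^^ n) g (\<phi> z)"
        using HspaceD(1)[OF that(1)] HspaceD(1)[OF that(2)] open_ball in_disk[OF True]
        by (rule higher_deriv_add)
      then show ?thesis using True by (simp add: Dop_def plus_fun_def algebra_simps)
    qed (simp add: Dop_def)
  qed
  show "Dop \<psi> \<phi> n (fscale c f) = fscale c (Dop \<psi> \<phi> n f)" if "f \<in> Hspace \<alpha>" for c f
  proof
    fix z
    show "Dop \<psi> \<phi> n (fscale c f) z = fscale c (Dop \<psi> \<phi> n f) z"
    proof (cases "z \<in> ball 0 1")
      case True
      have "(deriv ^^ n) (\<lambda>z. c * f z) (\<phi> z) = c * (deriv ^^ n) f (\<phi> z)"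
        using HspaceD(1)[OF that] in_disk[OF True] open_ball by (rule higher_deriv_cmult)
      then show ?thesis using True by (simp add: Dop_def fscale_def)
    qed (simp add: Dop_def fscale_def)
  qed
qed

section \<open>Taylor coefficients at the fixed point\<close>

text \<open>In the convolution sum one of the two factors is below its order, except for the single
  term \<open>i = p\<close> at index \<open>p + q\<close>.\<close>

lemma fps_mult_nth_lowest:
  fixes A B :: "'a::comm_ring_1 fps"
  assumes A: "\<And>i. i < p \<Longrightarrow> fps_nth A i = 0" and B: "\<And>i. i < q \<Longrightarrow> fps_nth B i = 0"
  shows "k < p + q \<Longrightarrow> fps_nth (A * B) k = 0"
    and "fps_nth (A * B) (p + q) = fps_nth A p * fps_nth B q"
proof -
  show "fps_nth (A * B) k = 0" if "k < p + q"
    unfolding fps_mult_nth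
  proof (intro sum.neutral ballI)
    fix i assume "i \<in> {0..k}"
    then have "i < p \<or> k - i < q" using that by auto
    then show "fps_nth A i * fps_nth B (k - i) = 0" using A B by auto
  qed
  have "fps_nth (A * B) (p + q) = (\<Sum>i\<in>{0..p + q}. if i = p then fps_nth A p * fps_nth B q else 0)"
    unfolding fps_mult_nth
  proof (intro sum.cong refl)
    fix i assume "i \<in> {0..p + q}"
    then have "i = p \<or> i < p \<or> p + q - i < q" by auto
    then show "fps_nth A i * fps_nth B (p + q - i) = (if i = p then fps_nth A p * fps_nth B q else 0)"
      using A B by auto
  qed
  then show "fps_nth (A * B) (p + q) = fps_nth A p * fps_nth B q" by simp
qed

text \<open>The \<open>i\<close>-th power of a series without constant term starts at degree
  \<open>i\<close>, so at degree \<open>p\<close> only the \<open>p\<close>-th power meets a nonzero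
  coefficient of \<open>G\<close>.\<close>

lemma fps_compose_nth_lowest:
  fixes G \<Phi> :: "'a::idom fps"
  assumes G: "\<And>i. i < p \<Longrightarrow> fps_nth G i = 0" and \<Phi>: "fps_nth \<Phi> 0 = 0"
  shows "k < p \<Longrightarrow> fps_nth (fps_compose G \<Phi>) k = 0"
    and "fps_nth (fps_compose G \<Phi>) p = fps_nth G p * fps_nth \<Phi> 1 ^ p"
proof -
  show "fps_nth (fps_compose G \<Phi>) k = 0" if "k < p"
    unfolding fps_compose_nth using that by (intro sum.neutral) (auto simp: G)
  have "fps_nth (fps_compose G \<Phi>) p = (\<Sum>i\<in>{0..p}. if i = p then fps_nth G p * fps_nth \<Phi> 1 ^ p else 0)"
    unfolding fps_compose_nth
    by (intro sum.cong refl) (auto simp: G startsby_zero_power_nth_same[OF \<Phi>])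
  then show "fps_nth (fps_compose G \<Phi>) p = fps_nth G p * fps_nth \<Phi> 1 ^ p" by simp
qed

lemma fps_nth_expansion: "fps_nth (fps_expansion f w) j = (deriv ^^ j) f w / fact j"
  by (simp add: fps_expansion_def)

text \<open>For \<open>m < n\<close> the binomial coefficient is 0, so the truncated exponent
  \<open>m - n\<close> does no harm.\<close>

definition Dop_diag :: "(complex \<Rightarrow> complex) \<Rightarrow> (complex \<Rightarrow> complex) \<Rightarrow> nat \<Rightarrow> complex \<Rightarrow> nat \<Rightarrow> complex" where
  "Dop_diag \<psi> \<phi> n w m = of_nat (m choose n) * (deriv ^^ n) \<psi> w * deriv \<phi> w ^ (m - n)"

text \<open>Orders of vanishing at \<open>w\<close> add up: at least \<open>n\<close> from \<psi>,
  and at least \<open>m - n\<close> from the \<open>n\<close>-th derivative of \<open>f\<close>, a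
  bound kept under composition with \<phi> since \<phi> fixes \<open>w\<close>. The factorials of
  the lowest coefficients combine to the binomial coefficient.\<close>

lemma higher_deriv_Dop:
  assumes \<psi>: "\<psi> holomorphic_on ball 0 1" and \<phi>: "\<phi> holomorphic_on ball 0 1"
    and w: "w \<in> ball 0 1" "\<phi> w = w" and \<psi>0: "\<And>j. j < n \<Longrightarrow> (deriv ^^ j) \<psi> w = 0"
    and f: "f holomorphic_on ball 0 1" and f0: "\<And>j. j < m \<Longrightarrow> (deriv ^^ j) f w = 0"
  shows "j < m \<Longrightarrow> (deriv ^^ j) (Dop \<psi> \<phi> n f) w = 0"
    and "(deriv ^^ m) (Dop \<psi> \<phi> n f) w = Dop_diag \<psi> \<phi> n w m * (deriv ^^ m) f w"
proof -
  have an: "h analytic_on {w}" if "h holomorphic_on ball 0 1" for h :: "complex \<Rightarrow> complex"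
    using that w(1) analytic_at open_ball by blast
  define \<Psi> where "\<Psi> = fps_expansion \<psi> w"
  define G where "G = fps_expansion ((deriv ^^ n) f) w"
  \<comment> \<open>Subtracting \<open>w\<close> removes the constant term, as composition of power
    series requires.\<close>
  define \<Phi> where "\<Phi> = fps_expansion \<phi> w - fps_const w"
  define H where "H = \<Psi> * fps_compose G \<Phi>"
  have \<Phi>0: "fps_nth \<Phi> 0 = 0" by (simp add: \<Phi>_def fps_nth_expansion w)
  have \<Phi>1: "fps_nth \<Phi> 1 = deriv \<phi> w" by (simp add: \<Phi>_def fps_nth_expansion)
  have "(\<lambda>x. (deriv ^^ n) f (w + x)) has_fps_expansion G"
    unfolding G_def using f
    by (intro analytic_at_imp_has_fps_expansion an holomorphic_higher_deriv) auto
  moreover have "(\<lambda>x. \<phi> (w + x) - w) has_fps_expansion \<Phi>"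
    unfolding \<Phi>_def using \<phi>
    by (intro has_fps_expansion_diff analytic_at_imp_has_fps_expansion an) auto
  ultimately have "((\<lambda>x. (deriv ^^ n) f (w + x)) \<circ> (\<lambda>x. \<phi> (w + x) - w)) has_fps_expansion fps_compose G \<Phi>"
    using \<Phi>0 by (rule has_fps_expansion_compose)
  moreover have "(\<lambda>x. \<psi> (w + x)) has_fps_expansion \<Psi>"
    unfolding \<Psi>_def using \<psi> by (intro analytic_at_imp_has_fps_expansion an)
  ultimately have "(\<lambda>x. \<psi> (w + x) * ((\<lambda>x. (deriv ^^ n) f (w + x)) \<circ> (\<lambda>x. \<phi> (w + x) - w)) x)
      has_fps_expansion H"
    unfolding H_def by (intro has_fps_expansion_mult)
  then have exp: "(\<lambda>x. \<psi> (w + x) * (deriv ^^ n) f (\<phi> (w + x))) has_fps_expansion H"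
    by (simp add: o_def)
  have ev: "\<forall>\<^sub>F x in nhds 0. \<psi> (w + x) * (deriv ^^ n) f (\<phi> (w + x)) = Dop \<psi> \<phi> n f (w + x)"
  proof -
    have "\<forall>\<^sub>F x in nhds 0. x \<in> (\<lambda>x. w + x) -` ball 0 1"
      using w(1) by (intro eventually_nhds_in_open open_vimage open_ball continuous_intros) simp
    then show ?thesis by eventually_elim (auto simp: Dop_def)
  qed
  have "fps_expansion (\<lambda>x. Dop \<psi> \<phi> n f (w + x)) 0 = H"
    by (intro fps_expansion_eqI iffD1[OF has_fps_expansion_cong[OF ev refl] exp])
  then have coeff: "(deriv ^^ j) (Dop \<psi> \<phi> n f) w = fact j * fps_nth H j" for j
    by (subst higher_deriv_shift_0) (auto simp: fps_expansion_def o_def)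
  have \<Psi>z: "fps_nth \<Psi> i = 0" if "i < n" for i
    using that \<psi>0 by (simp add: \<Psi>_def fps_nth_expansion)
  have Gn: "fps_nth G i = (deriv ^^ (i + n)) f w / fact i" for i
    by (simp add: G_def fps_nth_expansion funpow_add)
  have Gz: "fps_nth G i = 0" if "i < m - n" for i
    using that f0 by (simp add: Gn)
  note compose = fps_compose_nth_lowest[of "m - n" G \<Phi>, OF Gz \<Phi>0]
  note mult = fps_mult_nth_lowest[of n \<Psi> "m - n" "fps_compose G \<Phi>", OF \<Psi>z compose(1)]
  show "(deriv ^^ j) (Dop \<psi> \<phi> n f) w = 0" if "j < m"
    using mult(1)[of j] that by (simp add: coeff H_def)
  show "(deriv ^^ m) (Dop \<psi> \<phi> n f) w = Dop_diag \<psi> \<phi> n w m * (deriv ^^ m) f w"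
  proof (cases "n \<le> m")
    case True
    have "fps_nth H m = fps_nth \<Psi> n * fps_nth G (m - n) * fps_nth \<Phi> 1 ^ (m - n)"
      using mult(2) compose(2) True by (simp add: H_def mult.assoc)
    then show ?thesis using True
      by (simp add: coeff Dop_diag_def \<Phi>1[unfolded One_nat_def] Gn \<Psi>_def fps_nth_expansion binomial_fact)
  next
    \<comment> \<open>Here \<open>m - n\<close> is 0, so the product still vanishes below order
      \<open>n\<close>, in particular at \<open>m\<close>.\<close>
    case False
    then show ?thesis using mult(1)[of m] by (simp add: coeff H_def Dop_diag_def)
  qed
qed

section \<open>The spectral radius\<close>

text \<open>Compare the first nonvanishing derivative at \<open>w\<close> on both sides of the
  eigenvalue equation; it exists by the identity theorem.\<close>

lemma eigenvalue_is_diag: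
  assumes \<psi>: "\<psi> holomorphic_on ball 0 1" and \<phi>: "\<phi> holomorphic_on ball 0 1"
    and w: "w \<in> ball 0 1" "\<phi> w = w" and \<psi>0: "\<And>j. j < n \<Longrightarrow> (deriv ^^ j) \<psi> w = 0"
    and f: "f \<in> Hspace \<alpha>" "f \<noteq> 0" and eig: "Dop \<psi> \<phi> n f = fscale c f"
  shows "\<exists>m. c = Dop_diag \<psi> \<phi> n w m"
proof -
  note fh = HspaceD(1)[OF f(1)]
  have "\<exists>m. (deriv ^^ m) f w \<noteq> 0"
  proof (rule ccontr)
    assume "\<nexists>m. (deriv ^^ m) f w \<noteq> 0"
    then have "f z = 0" if "z \<in> ball 0 1" for z
      using holomorphic_fun_eq_0_on_connected[OF fh open_ball connected_ball _ w(1) that] by blast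
    with Hspace_eq_0I[OF f(1)] f(2) show False by blast
  qed
  then obtain m where m: "(deriv ^^ m) f w \<noteq> 0" "\<And>j. j < m \<Longrightarrow> (deriv ^^ j) f w = 0"
    using exists_least_iff[of "\<lambda>m. (deriv ^^ m) f w \<noteq> 0"] by blast
  have "Dop_diag \<psi> \<phi> n w m * (deriv ^^ m) f w = (deriv ^^ m) (Dop \<psi> \<phi> n f) w"
    using higher_deriv_Dop(2)[OF \<psi> \<phi> w \<psi>0 fh m(2)] by simp
  also have "\<dots> = c * (deriv ^^ m) f w"
    unfolding eig fscale_def using fh w(1) open_ball by (rule higher_deriv_cmult)
  finally show ?thesis using m(1) by auto
qed

text \<open>For the least \<open>m\<close> with diagonal entry \<open>c\<close>, the function \<open>(z - w)\<^sup>m\<close> is not in the range of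
  \<open>T - c\<close>: a preimage would have to vanish at \<open>w\<close> to order \<open>m\<close>, and then \<open>T - c\<close> also kills its
  \<open>m\<close>-th coefficient.\<close>

lemma diag_in_spectrum:
  assumes \<alpha>: "\<alpha> \<ge> -1"
    and \<psi>: "\<psi> holomorphic_on ball 0 1" and \<phi>: "\<phi> holomorphic_on ball 0 1"
    and w: "w \<in> ball 0 1" "\<phi> w = w" and \<psi>0: "\<And>j. j < n \<Longrightarrow> (deriv ^^ j) \<psi> w = 0"
    and T: "\<And>f. f \<in> Hspace \<alpha> \<Longrightarrow> Dop \<psi> \<phi> n f \<in> Hspace \<alpha>"
  shows "Dop_diag \<psi> \<phi> n w k \<in> Hspectrum \<alpha> (Dop \<psi> \<phi> n)"
proof -
  define c where "c = Dop_diag \<psi> \<phi> n w k"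
  obtain m where m: "Dop_diag \<psi> \<phi> n w m = c" "\<And>j. j < m \<Longrightarrow> Dop_diag \<psi> \<phi> n w j \<noteq> c"
    using exists_least_iff[of "\<lambda>m. Dop_diag \<psi> \<phi> n w m = c"] c_def by blast
  define g where "g = (\<lambda>z. if z \<in> ball 0 1 then (z - w) ^ m else 0)"
  have "cmod ((z - w) ^ m) \<le> 2 ^ m" if "z \<in> ball 0 1" for z
    using that w norm_triangle_ineq4[of z w]
    by (auto simp: norm_power intro!: power_mono)
  then have g: "g \<in> Hspace \<alpha>"
    unfolding g_def using \<alpha> by (intro Hspace_bounded[of _ _ "2 ^ m"] holomorphic_intros) auto
  \<comment> \<open>The value is 0 for \<open>j < m\<close> because of the power of 0, and
    \<open>fact m\<close> for \<open>j = m\<close>.\<close>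
  have gd: "(deriv ^^ j) g w = pochhammer (of_nat (Suc m - j)) j * 0 ^ (m - j)" for j
  proof -
    have "(deriv ^^ j) g w = (deriv ^^ j) (\<lambda>z. (z - w) ^ m) w"
      using HspaceD(1)[OF g] _ open_ball w(1)
      by (rule higher_deriv_transform_within_open) (auto simp: g_def intro!: holomorphic_intros)
    then show ?thesis by (simp add: higher_deriv_power)
  qed
  have "\<not> bij_betw (\<lambda>f z. Dop \<psi> \<phi> n f z - c * f z) (Hspace \<alpha>) (Hspace \<alpha>)"
  proof
    assume "bij_betw (\<lambda>f z. Dop \<psi> \<phi> n f z - c * f z) (Hspace \<alpha>) (Hspace \<alpha>)"
    then obtain f where f: "f \<in> Hspace \<alpha>" "g = (\<lambda>z. Dop \<psi> \<phi> n f z - c * f z)"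
      using g unfolding bij_betw_def by blast
    note fh = HspaceD(1)[OF f(1)]
    note Tfh = HspaceD(1)[OF T[OF f(1)]]
    have gd': "(deriv ^^ j) g w = (deriv ^^ j) (Dop \<psi> \<phi> n f) w - c * (deriv ^^ j) f w" for j
    proof -
      have "(deriv ^^ j) g w = (deriv ^^ j) (Dop \<psi> \<phi> n f) w - (deriv ^^ j) (\<lambda>z. c * f z) w"
        unfolding f(2) using Tfh _ open_ball w(1)
        by (rule higher_deriv_diff) (use fh in \<open>auto intro!: holomorphic_intros\<close>)
      also have "(deriv ^^ j) (\<lambda>z. c * f z) w = c * (deriv ^^ j) f w"
        using fh w(1) open_ball by (rule higher_deriv_cmult)
      finally show ?thesis .
    qed
    \<comment> \<open>Once the lower derivatives of \<open>f\<close> vanish, the \<open>j\<close>-th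
      derivative of the equation reads \<open>(d_j - c) f^(j)(w) = 0\<close>, and minimality of
      \<open>m\<close> makes the factor nonzero.\<close>
    have f0: "j < m \<Longrightarrow> (deriv ^^ j) f w = 0" for j
    proof (induction j rule: less_induct)
      case (less j)
      have "(deriv ^^ j) (Dop \<psi> \<phi> n f) w = Dop_diag \<psi> \<phi> n w j * (deriv ^^ j) f w"
        using less by (intro higher_deriv_Dop(2)[OF \<psi> \<phi> w \<psi>0 fh]) auto
      then have "(Dop_diag \<psi> \<phi> n w j - c) * (deriv ^^ j) f w = 0"
        using gd[of j] gd'[of j] less.prems by (simp add: algebra_simps)
      then show ?case using m(2)[OF less.prems] by simp
    qed
    have "(deriv ^^ m) g w = 0"
      using higher_deriv_Dop(2)[OF \<psi> \<phi> w \<psi>0 fh f0] m(1) by (simp add: gd')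
    moreover have "(deriv ^^ m) g w = fact m" by (simp add: gd pochhammer_fact)
    ultimately show False by simp
  qed
  then show ?thesis by (simp add: Hspectrum_def c_def)
qed

lemma nonzero_spectrum_eigenvalue:
  assumes "compact_operator fscale (Hspace \<alpha>) (Hnorm \<alpha>) T" "c \<in> Hspectrum \<alpha> T" "c \<noteq> 0"
  shows "\<exists>f\<in>Hspace \<alpha>. f \<noteq> 0 \<and> T f = fscale c f"
proof (rule ccontr)
  assume *: "\<not> ?thesis"
  interpret compact_operator fscale "Hspace \<alpha>" "Hnorm \<alpha>" T by (rule assms)
  have "bij_betw (\<lambda>f. T f - fscale c f) (Hspace \<alpha>) (Hspace \<alpha>)"
    using assms(3) * by (intro fredholm_alternative) blast+
  moreover have "(\<lambda>f. T f - fscale c f) = (\<lambda>f z. T f z - c * f z)"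
    by (simp add: fun_eq_iff fscale_def)
  ultimately show False using assms(2) by (simp add: Hspectrum_def)
qed

text \<open>The ratio of the terms at \<open>k + 1\<close> and \<open>k\<close> is
  \<open>(k + 1) a / (k + 1 - n)\<close>, which is at least 1 exactly when
  \<open>(k + 1) (1 - a) \<le> n\<close>, that is, when \<open>k + 1 \<le> N\<close>.\<close>

lemma binomial_power_le_max:
  fixes a :: real
  assumes a: "0 \<le> a" "a < 1" and N: "N = nat \<lfloor>real n / (1 - a)\<rfloor>"
  shows "real (m choose n) * a ^ (m - n) \<le> real (N choose n) * a ^ (N - n)"
proof -
  define b where "b m = real (m choose n) * a ^ (m - n)" for m
  have N_iff: "k \<le> N \<longleftrightarrow> real k * (1 - a) \<le> real n" for k
    using a unfolding N by (simp add: le_floor_iff le_nat_iff pos_le_divide_eq)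
  have "n \<le> N" using a by (simp add: N_iff mult_left_le)
  \<comment> \<open>Stated as a product, so that vanishing terms, as for \<open>a = 0\<close>, need
    no separate case.\<close>
  have step: "b (Suc k) * real (Suc k - n) = real (Suc k) * a * b k" if "n \<le> k" for k
  proof -
    have "real (Suc k - n) * real (Suc k choose n) = real (Suc k) * real (k choose n)"
      using binomial_absorb_comp[of "Suc k" n] by (metis diff_Suc_1 of_nat_mult)
    then show ?thesis using that by (simp add: b_def Suc_diff_le mult_ac)
  qed
  have b0: "b k \<ge> 0" for k using a by (simp add: b_def)
  have up: "b k \<le> b (Suc k)" if "n \<le> k" "Suc k \<le> N" for k
  proof -
    have "real (Suc k - n) \<le> real (Suc k) * a"
      using that N_iff[of "Suc k"] by (simp add: of_nat_diff algebra_simps)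
    then have "b k * real (Suc k - n) \<le> b (Suc k) * real (Suc k - n)"
      using b0[of k] step[OF that(1)] mult_right_mono[of _ _ "b k"] by (metis mult.commute)
    then show ?thesis using that by simp
  qed
  have down: "b (Suc k) \<le> b k" if "N \<le> k" for k
  proof -
    have "\<not> Suc k \<le> N" "n \<le> k" using that \<open>n \<le> N\<close> by auto
    then have "real (Suc k) * a \<le> real (Suc k - n)"
      using N_iff[of "Suc k"] by (simp add: of_nat_diff algebra_simps)
    then have "b (Suc k) * real (Suc k - n) \<le> b k * real (Suc k - n)"
      using b0[of k] step[OF \<open>n \<le> k\<close>] mult_right_mono[of _ _ "b k"] by (metis mult.commute)
    then show ?thesis using \<open>n \<le> k\<close> by simp
  qed
  consider "m < n" | "n \<le> m" "m \<le> N" | "N \<le> m" by linarith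
  then have "b m \<le> b N"
  proof cases
    case 1
    then show ?thesis using b0[of N] by (simp add: b_def binomial_eq_0)
  next
    case 2
    from 2(2) show ?thesis
    proof (induction rule: inc_induct)
      case (step k)
      then show ?case using up[of k] 2(1) by linarith
    qed simp
  next
    case 3
    then show ?thesis
    proof (induction rule: dec_induct)
      case (step k)
      then show ?case using down[of k] by linarith
    qed simp
  qed
  then show ?thesis by (simp add: b_def)
qed

theorem theorem2p5:
  fixes \<alpha> :: real and n :: nat and \<psi> \<phi> :: "complex \<Rightarrow> complex" and w :: complex
  assumes "\<alpha> \<ge> -1" and "n \<ge> 1"
    and "\<psi> holomorphic_on ball 0 1"
    and "\<phi> holomorphic_on ball 0 1" and "\<phi> ` ball 0 1 \<subseteq> ball 0 1"
    and "Hcompact_op \<alpha> (Dop \<psi> \<phi> n)"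
    and "w \<in> ball 0 1" and "\<phi> w = w"
    and "\<forall>j<n. (deriv ^^ j) \<psi> w = 0" and "(deriv ^^ n) \<psi> w \<noteq> 0"
  shows "Hspectral_radius \<alpha> (Dop \<psi> \<phi> n) =
           (let N = nat \<lfloor>real n / (1 - cmod (deriv \<phi> w))\<rfloor>
            in real (N choose n) * cmod ((deriv ^^ n) \<psi> w) * cmod (deriv \<phi> w) ^ (N - n))"
proof -
  let ?T = "Dop \<psi> \<phi> n" and ?d = "Dop_diag \<psi> \<phi> n w"
  define a where "a = cmod (deriv \<phi> w)"
  define P where "P = cmod ((deriv ^^ n) \<psi> w)"
  define N where "N = nat \<lfloor>real n / (1 - a)\<rfloor>"
  have P: "P > 0" using assms by (simp add: P_def)
  have \<psi>0: "\<And>j. j < n \<Longrightarrow> (deriv ^^ j) \<psi> w = 0" using assms by blast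
  have T: "compact_operator fscale (Hspace \<alpha>) (Hnorm \<alpha>) ?T"
    using assms by (intro compact_operator_Dop)
  interpret compact_operator fscale "Hspace \<alpha>" "Hnorm \<alpha>" ?T by (rule T)
  have cmod_d: "cmod (?d m) = P * (real (m choose n) * a ^ (m - n))" for m
    by (simp add: Dop_diag_def norm_mult norm_power a_def P_def)
  have d_spec: "?d m \<in> Hspectrum \<alpha> ?T" for m
    using assms \<psi>0 by (intro diag_in_spectrum) auto
  have spec_d: "\<exists>m. c = ?d m" if "c \<in> Hspectrum \<alpha> ?T" "c \<noteq> 0" for c
    using nonzero_spectrum_eigenvalue[OF T that] eigenvalue_is_diag[OF assms(3,4,7,8) \<psi>0] by blast
  have "a < 1"
  proof (rule ccontr)
    assume "\<not> a < 1"
    then have a: "a \<ge> 1" by simp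
    obtain B where B: "\<And>c f. f \<in> Hspace \<alpha> \<Longrightarrow> f \<noteq> 0 \<Longrightarrow> ?T f = fscale c f \<Longrightarrow> cmod c \<le> B"
      by (rule eigenvalue_bound) blast
    \<comment> \<open>The index \<open>n * k\<close> makes the lower bound
      \<open>(n k / n) ^ n\<close> for the binomial coefficient equal to \<open>k ^ n\<close>, which
      is at least \<open>k\<close>.\<close>
    have "P * real k \<le> B" if "k \<ge> 1" for k
    proof -
      have "real k \<le> real k ^ n" using that assms(2) by (intro self_le_power) auto
      also have "\<dots> = (real (n * k) / real n) ^ n" using assms(2) by simp
      also have "\<dots> \<le> real (n * k choose n)"
        using that by (intro binomial_ge_n_over_k_pow_k) simp
      also have "\<dots> \<le> real (n * k choose n) * a ^ (n * k - n)"
        using a by (simp add: mult_le_cancel_left1)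
      finally have "P * real k \<le> cmod (?d (n * k))"
        unfolding cmod_d using P by simp
      \<comment> \<open>A nonzero entry is required, because only nonzero spectral values are known
        to be eigenvalues.\<close>
      moreover have "P * real k > 0" using P that by simp
      ultimately have le: "P * real k \<le> cmod (?d (n * k))" and nz: "?d (n * k) \<noteq> 0" by auto
      obtain f where "f \<in> Hspace \<alpha>" "f \<noteq> 0" "?T f = fscale (?d (n * k)) f"
        using nonzero_spectrum_eigenvalue[OF T d_spec nz] by blast
      with B le show ?thesis by fastforce
    qed
    \<comment> \<open>Exceeding \<open>B / P\<close> breaks the bound; the maximum with 1 guarantees
      \<open>k \<ge> 1\<close>.\<close>
    moreover obtain k :: nat where "real k > max 1 (B / P)" using reals_Archimedean2 by blast
    ultimately show False using P by (auto simp: field_simps dest!: meta_spec[of _ k])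
  qed
  have "Hspectral_radius \<alpha> ?T = cmod (?d N)"
    unfolding Hspectral_radius_def
  proof (rule cSup_eq_maximum)
    show "cmod (?d N) \<in> cmod ` Hspectrum \<alpha> ?T" using d_spec by blast
    fix x assume "x \<in> cmod ` Hspectrum \<alpha> ?T"
    then obtain c where c: "c \<in> Hspectrum \<alpha> ?T" "x = cmod c" by blast
    show "x \<le> cmod (?d N)"
    \<comment> \<open>The value 0 may be spectral without being an eigenvalue, but it cannot exceed
      the claimed maximum.\<close>
    proof (cases "c = 0")
      case False
      then obtain m where "c = ?d m" using spec_d c by blast
      moreover have "real (m choose n) * a ^ (m - n) \<le> real (N choose n) * a ^ (N - n)"
        using \<open>a < 1\<close> by (intro binomial_power_le_max) (auto simp: a_def N_def)
      ultimately show ?thesis using c P by (simp add: cmod_d)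
    qed (use c in simp)
  qed
  then show ?thesis
    unfolding Let_def cmod_d by (simp add: a_def P_def N_def mult_ac)
qed

end
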